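(* Let $B$ be a fully commutative bimodule. Then $B$ is indecomposable in $\bar R-\mathrm{mod}_{\mathbb Z}-\bar R$.
   Context: **Weyl lines.** Let $n\ge 1$, $k$ a field of characteristic $0$, $\mathcal{W}=S_{n+1}$ (Coxeter group of type $A_n$) with simple reflections $s_i=(i,i+1)$, $1\le i\le n$; $T$ is the set of reflections (transpositions). $V$ is the $n$-dimensional geometric (reflection) representation of $\mathcal{W}$ over $k$ and $H_t\subset V$ the reflecting hyperplane of $t\in T$. A Weyl line is a one-dimensional subspace of $V$ that is an intersection of reflecting hyperplanes (for $n=1$, $V$ itself); it is transverse to $t\in T$ if it is not contained in $H_t$. $Z\subset V$ is the union of all Weyl lines; $V_t\subset Z$ is the union of the Weyl lines transverse to $t$; $V_i:=V_{s_i}$. **Rings.** $\mathcal{O}(X)$ is the algebra of regular functions on a closed subvariety $X\subset V$. $\bar R=\mathcal{O}(Z)$, $R_i=\mathcal{O}(V_i)$, graded as quotients of $\mathcal{O}(V)$ with $V^*$ in degree $2$; $R_i^{s_i}$ is the subring of $s_i$-invariants. $\bar R-\mathrm{mod}_{\mathbb Z}-\bar R$ is the category of $\mathbb{Z}$-graded $(\bar R,\bar R)$-bimodules with morphisms homogeneous of degree $0$. **Product.** For $B,B'$ in $\bar R-\mathrm{mod}_{\mathbb Z}-\bar R$, let $V_B^r\subset Z$ (resp. $V_{B'}^\ell\subset Z$) be the closed subvariety defined by the right annihilator of $B$ (resp. the left annihilator of $B'$) in $\bar R$, and set $B\ast B'=B\otimes_{\bar R}\mathcal{O}(V_B^r\cap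 V_{B'}^\ell)\otimes_{\bar R}B'$. Set $B_i=R_i\otimes_{R_i^{s_i}}R_i$. **Fully commutative bimodules.** $w\in\mathcal{W}$ is fully commutative if any reduced expression can be obtained from any other using only relations $st=ts$ with $s,t$ simple. For such $w$ with reduced expression $s_{i_1}\cdots s_{i_k}$, $B_w$ is any bimodule isomorphic in $\bar R-\mathrm{mod}_{\mathbb Z}-\bar R$ to $B_{i_1}\ast\cdots\ast B_{i_k}$ (independent, up to isomorphism, of bracketing and of the reduced expression; $B_e=\bar R$). A bimodule of the form $B_w$ is called fully commutative. *)

theory Defs
  imports
    "HOL-Algebra.Module"
    "HOL-Library.Multiset"
    "HOL-Combinatorics.Permutations"
begin

section \<open>The symmetric group and its geometric representation\<close>

text \<open>
  The group \<open>S\<^sub>n\<^sub>+\<^sub>1\<close> consists of the permutations of \<open>{1..n+1}\<close>; products of permutations are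
  compositions of functions.
\<close>

definition weyl_group :: "nat \<Rightarrow> (nat \<Rightarrow> nat) set" where
  "weyl_group n = {w. w permutes {1..n+1}}"

definition simple_refl :: "nat \<Rightarrow> nat \<Rightarrow> nat" where
  "simple_refl i = transpose i (Suc i)"

definition reflections :: "nat \<Rightarrow> (nat \<Rightarrow> nat) set" where
  "reflections n = {transpose a b |a b. a \<in> {1..n+1} \<and> b \<in> {1..n+1} \<and> a \<noteq> b}"

text \<open>
  The geometric representation of type \<open>A\<^sub>n\<close> is realised in the usual way as the space of vectors
  with coordinate sum zero, on which \<open>S\<^sub>n\<^sub>+\<^sub>1\<close> permutes the coordinates. The simple roots are
  \<open>\<alpha>\<^sub>i = e\<^sub>i - e\<^sub>i\<^sub>+\<^sub>1\<close>. A vector is a function that vanishes outside \<open>{1..n+1}\<close>.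
\<close>

type_synonym 'k point = "nat \<Rightarrow> 'k"

definition geom_rep :: "nat \<Rightarrow> 'k::field_char_0 point set" where
  "geom_rep n = {v. (\<forall>i. i \<notin> {1..n+1} \<longrightarrow> v i = 0) \<and> (\<Sum>i=1..n+1. v i) = 0}"

definition act :: "(nat \<Rightarrow> nat) \<Rightarrow> 'k point \<Rightarrow> 'k point" where
  "act w v = (\<lambda>i. v (inv_into UNIV w i))"

definition simple_root :: "nat \<Rightarrow> 'k::field_char_0 point" where
  "simple_root i = (\<lambda>j. if j = i then 1 else if j = Suc i then - 1 else 0)"

lemma simple_root_in_geom_rep:
  assumes "1 \<le> i" "i \<le> n"
  shows "simple_root i \<in> geom_rep n"
proof -
  have "(\<Sum>j=1..n+1. simple_root i j :: 'a) =
        (\<Sum>j=1..n+1. (if j = i then 1 else 0) + (if j = Suc i then - 1 else 0))"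
    by (rule sum.cong) (auto simp: simple_root_def)
  also have "\<dots> = 0"
    using assms by (simp add: sum.distrib)
  finally show ?thesis
    using assms by (auto simp: geom_rep_def simple_root_def)
qed

text \<open>The defining formula of the geometric representation, with the Cartan matrix of type \<open>A\<^sub>n\<close>.\<close>

lemma act_simple_refl_simple_root:
  "act (simple_refl i) (simple_root j :: 'k::field_char_0 point) =
     (\<lambda>l. simple_root j l -
        (if i = j then 2 else if i = Suc j \<or> j = Suc i then - 1 else 0) * simple_root i l)"
  by (rule ext) (auto simp: act_def simple_refl_def simple_root_def transpose_def inv_transpose_eq)

definition refl_hyperplane :: "nat \<Rightarrow> (nat \<Rightarrow> nat) \<Rightarrow> 'k::field_char_0 point set" where
  "refl_hyperplane n t = {v \<in> geom_rep n. act t v = v}"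


section \<open>Weyl lines\<close>

definition one_dimensional :: "'k::field_char_0 point set \<Rightarrow> bool" where
  "one_dimensional L \<longleftrightarrow> (\<exists>v. v \<noteq> (\<lambda>_. 0) \<and> L = {(\<lambda>i. c * v i) |c. True})"

text \<open>
  The empty intersection is the whole space; it is one-dimensional exactly for \<open>n = 1\<close>, in which
  case it is the unique Weyl line.
\<close>

definition weyl_lines :: "nat \<Rightarrow> 'k::field_char_0 point set set" where
  "weyl_lines n =
     {L. one_dimensional L \<and>
         (\<exists>A \<subseteq> reflections n. L = geom_rep n \<inter> (\<Inter>t\<in>A. refl_hyperplane n t))}"

definition transverse :: "nat \<Rightarrow> 'k::field_char_0 point set \<Rightarrow> (nat \<Rightarrow> nat) \<Rightarrow> bool" where
  "transverse n L t \<longleftrightarrow> \<not> L \<subseteq> refl_hyperplane n t"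

definition weyl_lines_union :: "nat \<Rightarrow> 'k::field_char_0 point set" where
  "weyl_lines_union n = \<Union> (weyl_lines n)"

definition transverse_union :: "nat \<Rightarrow> (nat \<Rightarrow> nat) \<Rightarrow> 'k::field_char_0 point set" where
  "transverse_union n t = \<Union> {L \<in> weyl_lines n. transverse n L t}"


section \<open>Rings of regular functions\<close>

inductive_set poly_fun :: "('k::field_char_0 point \<Rightarrow> 'k) set" where
  const: "(\<lambda>_. c) \<in> poly_fun"
| coord: "(\<lambda>v. v i) \<in> poly_fun"
| add: "\<lbrakk>p \<in> poly_fun; q \<in> poly_fun\<rbrakk> \<Longrightarrow> (\<lambda>v. p v + q v) \<in> poly_fun"
| mult: "\<lbrakk>p \<in> poly_fun; q \<in> poly_fun\<rbrakk> \<Longrightarrow> (\<lambda>v. p v * q v) \<in> poly_fun"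

inductive homog_poly_fun :: "nat \<Rightarrow> ('k::field_char_0 point \<Rightarrow> 'k) \<Rightarrow> bool" where
  const: "homog_poly_fun 0 (\<lambda>_. c)"
| coord: "homog_poly_fun 1 (\<lambda>v. v i)"
| add: "\<lbrakk>homog_poly_fun m p; homog_poly_fun m q\<rbrakk> \<Longrightarrow> homog_poly_fun m (\<lambda>v. p v + q v)"
| mult: "\<lbrakk>homog_poly_fun m p; homog_poly_fun l q\<rbrakk> \<Longrightarrow> homog_poly_fun (m + l) (\<lambda>v. p v * q v)"

record 'r graded_ring = "'r ring" +
  ring_grade :: "int \<Rightarrow> 'r set"

text \<open>
  A regular function on \<open>X\<close> is represented by its extension by zero to all points. With this
  convention all ring operations are pointwise, the unit is the indicator function of \<open>X\<close>, and
  for \<open>Y \<subseteq> X\<close> the action of \<open>\<O>(X)\<close> on \<open>\<O>(Y)\<close> through restriction is pointwise multiplication.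
  Linear forms have degree 2.
\<close>

definition restr :: "'k::field_char_0 point set \<Rightarrow> ('k point \<Rightarrow> 'k) \<Rightarrow> 'k point \<Rightarrow> 'k" where
  "restr X p = (\<lambda>v. if v \<in> X then p v else 0)"

definition regular_ring :: "'k::field_char_0 point set \<Rightarrow> ('k point \<Rightarrow> 'k) graded_ring" where
  "regular_ring X =
     \<lparr>carrier = restr X ` poly_fun,
      monoid.mult = (\<lambda>f g v. f v * g v),
      one = restr X (\<lambda>_. 1),
      zero = (\<lambda>_. 0),
      add = (\<lambda>f g v. f v + g v),
      ring_grade = (\<lambda>d. if 0 \<le> d \<and> even d
                        then restr X ` {p. homog_poly_fun (nat (d div 2)) p}
                        else {\<lambda>_. 0})\<rparr>"

definition Rbar :: "nat \<Rightarrow> ('k::field_char_0 point \<Rightarrow> 'k) graded_ring" where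
  "Rbar n = regular_ring (weyl_lines_union n)"

definition R_simple :: "nat \<Rightarrow> nat \<Rightarrow> ('k::field_char_0 point \<Rightarrow> 'k) graded_ring" where
  "R_simple n i = regular_ring (transverse_union n (simple_refl i))"

definition R_invariant :: "nat \<Rightarrow> nat \<Rightarrow> ('k::field_char_0 point \<Rightarrow> 'k) graded_ring" where
  "R_invariant n i =
     (let inv_funs = {f \<in> carrier (R_simple n i).
                        \<forall>v \<in> transverse_union n (simple_refl i). f (act (simple_refl i) v) = f v}
      in (R_simple n i)\<lparr>carrier := inv_funs,
                        ring_grade := (\<lambda>d. ring_grade (R_simple n i) d \<inter> inv_funs)\<rparr>)"


section \<open>Graded bimodules\<close>

text \<open>
  The fields \<^const>\<open>monoid.mult\<close> and \<^const>\<open>one\<close> inherited from rings carry no meaning here, as for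
  modules in the library.
\<close>

record ('r, 'b) gbimod = "('r, 'b) module" +
  rsmult :: "'b \<Rightarrow> 'r \<Rightarrow> 'b"
  grade :: "int \<Rightarrow> 'b set"

text \<open>Both rings are commutative, so that a right module is a module for the swapped action.\<close>

definition graded_bimodule ::
  "'r graded_ring \<Rightarrow> 'r graded_ring \<Rightarrow> ('r, 'b) gbimod \<Rightarrow> bool" where
  "graded_bimodule R S M \<longleftrightarrow>
     module R M \<and>
     module S (M\<lparr>smult := (\<lambda>s m. rsmult M m s)\<rparr>) \<and>
     (\<forall>r \<in> carrier R. \<forall>s \<in> carrier S. \<forall>m \<in> carrier M.
        rsmult M (smult M r m) s = smult M r (rsmult M m s)) \<and>
     (\<forall>d. subgroup (grade M d) (add_monoid M)) \<and>
     (\<forall>m \<in> carrier M. \<exists>!c :: int \<Rightarrow> 'b.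
        (\<forall>d. c d \<in> grade M d) \<and> finite {d. c d \<noteq> \<zero>\<^bsub>M\<^esub>} \<and>
        m = finsum M c {d. c d \<noteq> \<zero>\<^bsub>M\<^esub>}) \<and>
     (\<forall>a d. \<forall>r \<in> ring_grade R a. \<forall>m \<in> grade M d. smult M r m \<in> grade M (a + d)) \<and>
     (\<forall>a d. \<forall>s \<in> ring_grade S a. \<forall>m \<in> grade M d. rsmult M m s \<in> grade M (d + a))"

definition bimod_hom ::
  "'r graded_ring \<Rightarrow> 'r graded_ring \<Rightarrow> ('r, 'b) gbimod \<Rightarrow> ('r, 'c) gbimod \<Rightarrow> ('b \<Rightarrow> 'c) set" where
  "bimod_hom R S M N =
     {\<phi> \<in> carrier M \<rightarrow> carrier N.
        (\<forall>x \<in> carrier M. \<forall>y \<in> carrier M. \<phi> (x \<oplus>\<^bsub>M\<^esub> y) = \<phi> x \<oplus>\<^bsub>N\<^esub> \<phi> y) \<and>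
        (\<forall>r \<in> carrier R. \<forall>x \<in> carrier M. \<phi> (smult M r x) = smult N r (\<phi> x)) \<and>
        (\<forall>s \<in> carrier S. \<forall>x \<in> carrier M. \<phi> (rsmult M x s) = rsmult N (\<phi> x) s) \<and>
        (\<forall>d. \<phi> ` grade M d \<subseteq> grade N d)}"

definition bimod_iso ::
  "'r graded_ring \<Rightarrow> 'r graded_ring \<Rightarrow> ('r, 'b) gbimod \<Rightarrow> ('r, 'c) gbimod \<Rightarrow> bool" where
  "bimod_iso R S M N \<longleftrightarrow>
     (\<exists>\<phi> \<in> bimod_hom R S M N. \<exists>\<psi> \<in> bimod_hom R S N M.
        (\<forall>x \<in> carrier M. \<psi> (\<phi> x) = x) \<and> (\<forall>y \<in> carrier N. \<phi> (\<psi> y) = y))"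

definition bimod_sum :: "('r, 'b) gbimod \<Rightarrow> ('r, 'c) gbimod \<Rightarrow> ('r, 'b \<times> 'c) gbimod" where
  "bimod_sum M N =
     \<lparr>carrier = carrier M \<times> carrier N,
      monoid.mult = undefined,
      one = undefined,
      zero = (\<zero>\<^bsub>M\<^esub>, \<zero>\<^bsub>N\<^esub>),
      add = (\<lambda>(x, y) (x', y'). (x \<oplus>\<^bsub>M\<^esub> x', y \<oplus>\<^bsub>N\<^esub> y')),
      smult = (\<lambda>r (x, y). (smult M r x, smult N r y)),
      rsmult = (\<lambda>(x, y) s. (rsmult M x s, rsmult N y s)),
      grade = (\<lambda>d. grade M d \<times> grade N d)\<rparr>"

text \<open>
  Every direct summand of \<open>B\<close> is isomorphic to a subobject of \<open>B\<close>, so nothing is lost by letting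
  the summands range over bimodules with elements in the type of those of \<open>B\<close>. The zero object is
  not indecomposable.
\<close>

definition indecomposable ::
  "'r graded_ring \<Rightarrow> 'r graded_ring \<Rightarrow> ('r, 'b) gbimod \<Rightarrow> bool" where
  "indecomposable R S B \<longleftrightarrow>
     carrier B \<noteq> {\<zero>\<^bsub>B\<^esub>} \<and>
     (\<forall>(M :: ('r, 'b) gbimod) (N :: ('r, 'b) gbimod).
        graded_bimodule R S M \<longrightarrow> graded_bimodule R S N \<longrightarrow> bimod_iso R S B (bimod_sum M N) \<longrightarrow>
        carrier M = {\<zero>\<^bsub>M\<^esub>} \<or> carrier N = {\<zero>\<^bsub>N\<^esub>})"


section \<open>Tensor products\<close>

text \<open>
  A formal sum of pure tensors is a multiset of pairs, and the tensor product over \<open>S\<close> is the set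
  of formal sums modulo \<open>tensor_rel\<close>, the congruence generated by biadditivity and \<open>S\<close>-balancedness.
  Formal differences are not needed, since \<open>- (x \<otimes> y) = (- x) \<otimes> y\<close>. To be able to iterate the
  construction inside a single type, the elements are taken in a type closed under formal sums and
  every congruence class is represented by a chosen member.
\<close>

datatype 'a tens = Atom 'a | Formal "('a tens \<times> 'a tens) multiset"

primrec terms :: "'a tens \<Rightarrow> ('a tens \<times> 'a tens) multiset" where
  "terms (Atom a) = {#}"
| "terms (Formal u) = u"

definition formal_sums ::
  "('r, 'a tens) gbimod \<Rightarrow> ('r, 'a tens) gbimod \<Rightarrow> ('a tens \<times> 'a tens) multiset set" where
  "formal_sums M N = {u. set_mset u \<subseteq> carrier M \<times> carrier N}"

inductive tensor_rel ::
  "'r graded_ring \<Rightarrow> ('r, 'a tens) gbimod \<Rightarrow> ('r, 'a tens) gbimod \<Rightarrow>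
   ('a tens \<times> 'a tens) multiset \<Rightarrow> ('a tens \<times> 'a tens) multiset \<Rightarrow> bool"
  for S M N where
  refl: "u \<in> formal_sums M N \<Longrightarrow> tensor_rel S M N u u"
| sym: "tensor_rel S M N u v \<Longrightarrow> tensor_rel S M N v u"
| trans: "\<lbrakk>tensor_rel S M N u v; tensor_rel S M N v w\<rbrakk> \<Longrightarrow> tensor_rel S M N u w"
| cong: "\<lbrakk>tensor_rel S M N u v; w \<in> formal_sums M N\<rbrakk> \<Longrightarrow> tensor_rel S M N (u + w) (v + w)"
| zero_left: "y \<in> carrier N \<Longrightarrow> tensor_rel S M N {#(\<zero>\<^bsub>M\<^esub>, y)#} {#}"
| zero_right: "x \<in> carrier M \<Longrightarrow> tensor_rel S M N {#(x, \<zero>\<^bsub>N\<^esub>)#} {#}"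
| add_left: "\<lbrakk>x \<in> carrier M; x' \<in> carrier M; y \<in> carrier N\<rbrakk> \<Longrightarrow>
    tensor_rel S M N {#(x \<oplus>\<^bsub>M\<^esub> x', y)#} {#(x, y), (x', y)#}"
| add_right: "\<lbrakk>x \<in> carrier M; y \<in> carrier N; y' \<in> carrier N\<rbrakk> \<Longrightarrow>
    tensor_rel S M N {#(x, y \<oplus>\<^bsub>N\<^esub> y')#} {#(x, y), (x, y')#}"
| balanced: "\<lbrakk>x \<in> carrier M; s \<in> carrier S; y \<in> carrier N\<rbrakk> \<Longrightarrow>
    tensor_rel S M N {#(rsmult M x s, y)#} {#(x, smult N s y)#}"

definition tensor_class ::
  "'r graded_ring \<Rightarrow> ('r, 'a tens) gbimod \<Rightarrow> ('r, 'a tens) gbimod \<Rightarrow>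
   ('a tens \<times> 'a tens) multiset \<Rightarrow> 'a tens" where
  "tensor_class S M N u = Formal (SOME v. tensor_rel S M N u v)"

lemma tensor_class_eq_iff:
  assumes "u \<in> formal_sums M N" "v \<in> formal_sums M N"
  shows "tensor_class S M N u = tensor_class S M N v \<longleftrightarrow> tensor_rel S M N u v"
proof
  assume "tensor_class S M N u = tensor_class S M N v"
  moreover have "tensor_rel S M N u (SOME w. tensor_rel S M N u w)"
    by (rule someI) (rule tensor_rel.refl[OF assms(1)])
  moreover have "tensor_rel S M N v (SOME w. tensor_rel S M N v w)"
    by (rule someI) (rule tensor_rel.refl[OF assms(2)])
  ultimately show "tensor_rel S M N u v"
    unfolding tensor_class_def by (metis tens.inject(2) tensor_rel.sym tensor_rel.trans)
next
  assume "tensor_rel S M N u v"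
  then have "tensor_rel S M N u = tensor_rel S M N v"
    by (intro ext) (metis tensor_rel.sym tensor_rel.trans)
  then show "tensor_class S M N u = tensor_class S M N v"
    unfolding tensor_class_def by simp
qed

definition tensor ::
  "'r graded_ring \<Rightarrow> ('r, 'a tens) gbimod \<Rightarrow> ('r, 'a tens) gbimod \<Rightarrow> ('r, 'a tens) gbimod" where
  "tensor S M N =
     \<lparr>carrier = tensor_class S M N ` formal_sums M N,
      monoid.mult = undefined,
      one = undefined,
      zero = tensor_class S M N {#},
      add = (\<lambda>a b. tensor_class S M N (terms a + terms b)),
      smult = (\<lambda>r a. tensor_class S M N (image_mset (\<lambda>(x, y). (smult M r x, y)) (terms a))),
      rsmult = (\<lambda>a r. tensor_class S M N (image_mset (\<lambda>(x, y). (x, rsmult N y r)) (terms a))),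
      grade = (\<lambda>d. tensor_class S M N `
                 {u. set_mset u \<subseteq> (\<Union>a. grade M a \<times> grade N (d - a))})\<rparr>"


section \<open>The bimodules \<open>B\<^sub>i\<close> and the product\<close>

text \<open>
  \<open>\<O>(X)\<close> with left and right multiplication. This serves as a bimodule over \<open>\<O>(Y)\<close> for
  every \<open>Y \<supseteq> X\<close>, and over subrings of \<open>\<O>(X)\<close>.
\<close>

definition regular_bimod ::
  "'k::field_char_0 point set \<Rightarrow> ('k point \<Rightarrow> 'k, ('k point \<Rightarrow> 'k) tens) gbimod" where
  "regular_bimod X =
     \<lparr>carrier = Atom ` carrier (regular_ring X),
      monoid.mult = undefined,
      one = undefined,
      zero = Atom (\<lambda>_. 0),
      add = (\<lambda>a b. case (a, b) of (Atom f, Atom g) \<Rightarrow> Atom (\<lambda>v. f v + g v) | _ \<Rightarrow> undefined),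
      smult = (\<lambda>r a. case a of Atom f \<Rightarrow> Atom (\<lambda>v. r v * f v) | _ \<Rightarrow> undefined),
      rsmult = (\<lambda>a r. case a of Atom f \<Rightarrow> Atom (\<lambda>v. f v * r v) | _ \<Rightarrow> undefined),
      grade = (\<lambda>d. Atom ` ring_grade (regular_ring X) d)\<rparr>"

definition B_simple ::
  "nat \<Rightarrow> nat \<Rightarrow> ('k::field_char_0 point \<Rightarrow> 'k, ('k point \<Rightarrow> 'k) tens) gbimod" where
  "B_simple n i =
     tensor (R_invariant n i)
       (regular_bimod (transverse_union n (simple_refl i)))
       (regular_bimod (transverse_union n (simple_refl i)))"

definition left_annihilator :: "'r graded_ring \<Rightarrow> ('r, 'b) gbimod \<Rightarrow> 'r set" where
  "left_annihilator R M = {r \<in> carrier R. \<forall>x \<in> carrier M. smult M r x = \<zero>\<^bsub>M\<^esub>}"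

definition right_annihilator :: "'r graded_ring \<Rightarrow> ('r, 'b) gbimod \<Rightarrow> 'r set" where
  "right_annihilator R M = {r \<in> carrier R. \<forall>x \<in> carrier M. rsmult M x r = \<zero>\<^bsub>M\<^esub>}"

text \<open>
  Closed subvarieties are given by their \<open>k\<close>-rational points. This loses nothing here: the
  annihilator of a graded bimodule is a homogeneous ideal, and its zero locus on a union of
  \<open>k\<close>-rational lines is again a union of some of these lines, \<open>{0}\<close> or empty.
\<close>

definition left_support ::
  "nat \<Rightarrow> ('k::field_char_0 point \<Rightarrow> 'k, 'b) gbimod \<Rightarrow> 'k point set" where
  "left_support n M = {z \<in> weyl_lines_union n. \<forall>r \<in> left_annihilator (Rbar n) M. r z = 0}"

definition right_support ::
  "nat \<Rightarrow> ('k::field_char_0 point \<Rightarrow> 'k, 'b) gbimod \<Rightarrow> 'k point set" where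
  "right_support n M = {z \<in> weyl_lines_union n. \<forall>r \<in> right_annihilator (Rbar n) M. r z = 0}"

definition star ::
  "nat \<Rightarrow> ('k::field_char_0 point \<Rightarrow> 'k, ('k point \<Rightarrow> 'k) tens) gbimod
   \<Rightarrow> ('k point \<Rightarrow> 'k, ('k point \<Rightarrow> 'k) tens) gbimod
   \<Rightarrow> ('k point \<Rightarrow> 'k, ('k point \<Rightarrow> 'k) tens) gbimod" where
  "star n M N =
     tensor (Rbar n)
       (tensor (Rbar n) M (regular_bimod (right_support n M \<inter> left_support n N))) N"

text \<open>
  The product of the \<open>B\<^sub>i\<close> along a word, bracketed to the left; other bracketings give isomorphic
  bimodules.
\<close>

fun B_word ::
  "nat \<Rightarrow> nat list \<Rightarrow> ('k::field_char_0 point \<Rightarrow> 'k, ('k point \<Rightarrow> 'k) tens) gbimod" where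
  "B_word n [] = regular_bimod (weyl_lines_union n)"
| "B_word n (i # is) = foldl (\<lambda>M j. star n M (B_simple n j)) (B_simple n i) is"


section \<open>Fully commutative elements and bimodules\<close>

definition word_prod :: "nat list \<Rightarrow> nat \<Rightarrow> nat" where
  "word_prod is = foldr (\<lambda>i w. simple_refl i \<circ> w) is id"

definition reduced_expr :: "nat \<Rightarrow> (nat \<Rightarrow> nat) \<Rightarrow> nat list \<Rightarrow> bool" where
  "reduced_expr n w is \<longleftrightarrow>
     set is \<subseteq> {1..n} \<and> word_prod is = w \<and>
     (\<forall>js. set js \<subseteq> {1..n} \<and> word_prod js = w \<longrightarrow> length is \<le> length js)"

inductive comm_move :: "nat list \<Rightarrow> nat list \<Rightarrow> bool" where
  "simple_refl i \<circ> simple_refl j = simple_refl j \<circ> simple_refl i \<Longrightarrow>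
   comm_move (us @ [i, j] @ vs) (us @ [j, i] @ vs)"

definition fully_commutative :: "nat \<Rightarrow> (nat \<Rightarrow> nat) \<Rightarrow> bool" where
  "fully_commutative n w \<longleftrightarrow>
     w \<in> weyl_group n \<and>
     (\<forall>is js. reduced_expr n w is \<longrightarrow> reduced_expr n w js \<longrightarrow> comm_move\<^sup>*\<^sup>* is js)"

definition fully_commutative_bimodule ::
  "nat \<Rightarrow> ('k::field_char_0 point \<Rightarrow> 'k, 'b) gbimod \<Rightarrow> bool" where
  "fully_commutative_bimodule n B \<longleftrightarrow>
     graded_bimodule (Rbar n) (Rbar n) B \<and>
     (\<exists>w is. fully_commutative n w \<and> reduced_expr n w is \<and>
             bimod_iso (Rbar n) (Rbar n) B (B_word n is))"

end

theory Submission
  imports Defs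
begin

text \<open>
  A fully commutative bimodule is generated, as a bimodule, by the single element
  \<open>e = 1 \<otimes> \<dots> \<otimes> 1\<close> of degree zero. Since \<open>\<O>(Z)\<close> is generated in degree 2 over the constants, and
  these act on \<open>e\<close> in the same way from both sides, the component of degree zero is the line
  spanned by \<open>e\<close>. In a decomposition \<open>B = M \<oplus> N\<close> this line lies in one summand, which therefore
  is all of \<open>B\<close> (\<open>cyclic_graded.indecomposable\<close>). The generator is not zero, because the functions in
  all tensor factors can be evaluated at a point that lies on all the \<open>V\<^sub>i\<close>, namely one whose
  coordinates take two values alternatingly.

  It remains to see that \<open>B\<^sub>w\<close> is cyclic. The coordinates of a nonzero point of a Weyl line take just two
  values, and the line is transverse to \<open>s\<^sub>i\<close> exactly if the coordinates \<open>i\<close> and \<open>i + 1\<close> differ. Hence the sum of the two values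
  is \<open>x\<^sub>i + x\<^sub>i\<^sub>+\<^sub>1\<close> on \<open>V\<^sub>i\<close>, for every \<open>i\<close>; it crosses all tensor signs. A coordinate
  \<open>x\<^sub>m\<close> crosses \<open>B\<^sub>i\<close> if \<open>m\<close> is not \<open>i\<close> or \<open>i + 1\<close>, while next to \<open>B\<^sub>i\<close> the functions \<open>x\<^sub>i\<close> and \<open>x\<^sub>i\<^sub>+\<^sub>1\<close>
  can be exchanged at the cost of that sum. A coordinate function in an inner tensor factor may thus be
  transported along the strands of the Temperley-Lieb diagram of the word, until it leaves the diagram
  on the left or on the right and becomes a scalar. This works whenever the diagram has no closed loop
  (\<open>strand_step.mid_generated\<close>, \<open>strand_step.star_strands\<close>).

  Closed loops do not occur for fully commutative elements. In a reduced word of such an element,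
  any two consecutive occurrences of a letter enclose both neighbouring letters
  (\<open>between_consecutive_occurrences\<close>). A strand therefore never reverses its direction,
  so no strand leads from position \<open>j\<close> back to position \<open>j + 1\<close> in front of a further letter \<open>j\<close>
  (\<open>no_closed_loop\<close>).
\<close>


section \<open>Words, strands and the absence of closed loops\<close>

lemma simple_refl_involution: "simple_refl i \<circ> simple_refl i = id"
  by (simp add: simple_refl_def)

lemma simple_refl_commute:
  assumes "j \<noteq> i" "j \<noteq> Suc i" "i \<noteq> Suc j"
  shows "simple_refl i \<circ> simple_refl j = simple_refl j \<circ> simple_refl i"
  using assms by (auto simp: simple_refl_def transpose_def fun_eq_iff)

lemma simple_refl_braid:
  "simple_refl i \<circ> simple_refl (Suc i) \<circ> simple_refl i =
   simple_refl (Suc i) \<circ> simple_refl i \<circ> simple_refl (Suc i)"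
  by (auto simp: simple_refl_def transpose_def fun_eq_iff)

lemma word_prod_Cons: "word_prod (i # is) = simple_refl i \<circ> word_prod is"
  by (simp add: word_prod_def)

lemma word_prod_Nil: "word_prod [] = id"
  by (simp add: word_prod_def)

lemma word_prod_append: "word_prod (us @ vs) = word_prod us \<circ> word_prod vs"
  by (induction us) (simp_all add: word_prod_Nil word_prod_Cons comp_assoc)

lemma word_prod_commute:
  assumes "\<And>i. i \<in> set us \<Longrightarrow> simple_refl i \<circ> simple_refl j = simple_refl j \<circ> simple_refl i"
  shows "word_prod us \<circ> simple_refl j = simple_refl j \<circ> word_prod us"
  using assms
proof (induction us)
  case (Cons i us)
  have "word_prod us \<circ> simple_refl j = simple_refl j \<circ> word_prod us"
    by (rule Cons.IH) (rule Cons.prems, simp)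
  moreover have "simple_refl i \<circ> simple_refl j = simple_refl j \<circ> simple_refl i"
    by (rule Cons.prems) simp
  ultimately show ?case unfolding word_prod_Cons by (metis comp_assoc)
qed (simp add: word_prod_Nil)

lemma comm_move_mset: "comm_move\<^sup>*\<^sup>* is js \<Longrightarrow> mset is = mset js"
  by (induction rule: rtranclp_induct) (auto elim!: comm_move.cases)

lemma fully_commutative_mset_eq:
  assumes "fully_commutative n w" "reduced_expr n w is"
    and "set js \<subseteq> {1..n}" "word_prod js = w" "length js = length is"
  shows "mset is = mset js"
proof -
  have "reduced_expr n w js"
    using assms by (auto simp: reduced_expr_def)
  then show ?thesis
    using assms(1,2) comm_move_mset by (auto simp: fully_commutative_def)
qed

lemma split_two_occurrences:
  assumes "2 \<le> count_list xs a"
  obtains us ms vs where "xs = us @ [a] @ ms @ [a] @ vs" "a \<notin> set ms"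
proof -
  have "a \<in> set xs" using assms by (metis count_notin not_numeral_le_zero)
  then obtain us ys where xs: "xs = us @ a # ys" "a \<notin> set us"
    by (metis split_list_first)
  have "a \<in> set ys" using assms xs by (metis (no_types) Suc_1 count_list.simps(2) count_list_append
        count_notin not_less_eq_eq order_refl add_0 One_nat_def add_Suc_right add.commute plus_1_eq_Suc)
  then obtain ms vs where "ys = ms @ a # vs" "a \<notin> set ms"
    by (metis split_list_first)
  then show ?thesis using that[of us ms vs] xs by simp
qed

text \<open>
  Between two consecutive letters \<open>j\<close> let only one of the two neighbouring letters, \<open>t\<close>, occur. If it
  does not occur at all, the two \<open>j\<close> can be moved together and cancel, so the word is not reduced.
  If it occurs once, they can be moved next to it; the braid relation then turns \<open>j t j\<close> into
  \<open>t j t\<close>, which changes the multiset of letters, whereas commutation moves preserve it.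
\<close>

lemma neighbour_occurs_twice:
  assumes fc: "fully_commutative n w" and red: "reduced_expr n w (us @ [j] @ ms @ [j] @ vs)"
    and adj: "t = Suc j \<or> j = Suc t" and ms: "j \<notin> set ms"
    and only: "\<And>i. i \<in> set ms \<Longrightarrow> i = Suc j \<or> j = Suc i \<Longrightarrow> i = t"
  shows "2 \<le> count_list ms t"
proof (rule ccontr)
  let ?s = simple_refl and ?p = word_prod
  have sub: "set (us @ [j] @ ms @ [j] @ vs) \<subseteq> {1..n}" and w: "?p (us @ [j] @ ms @ [j] @ vs) = w"
    and least: "\<And>js. set js \<subseteq> {1..n} \<Longrightarrow> ?p js = w \<Longrightarrow> length (us @ [j] @ ms @ [j] @ vs) \<le> length js"
    using red by (auto simp: reduced_expr_def)
  assume "\<not> 2 \<le> count_list ms t"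
  then consider "count_list ms t = 0" | "count_list ms t = 1" by linarith
  then show False
  proof cases
    case 1
    then have c: "?p ms \<circ> ?s j = ?s j \<circ> ?p ms"
      by (intro word_prod_commute simple_refl_commute) (use ms only count_list_0_iff in metis)+
    have "?p (us @ ms @ vs) = w"
      unfolding w[symmetric]
      by (simp add: fun_eq_iff word_prod_append word_prod_Cons word_prod_Nil
          fun_cong[OF c, simplified] fun_cong[OF simple_refl_involution, simplified])
    moreover have "set (us @ ms @ vs) \<subseteq> {1..n}" using sub by auto
    ultimately show False using least[of "us @ ms @ vs"] by simp
  next
    case 2
    then have "t \<in> set ms" by (metis count_notin zero_neq_one)
    then obtain as bs where m: "ms = as @ t # bs" "t \<notin> set as" by (metis split_list_first)
    with 2 have "count_list bs t = 0" by simp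
    then have bs: "t \<notin> set bs" by (simp add: count_list_0_iff)
    have nc: "?s i \<circ> ?s j = ?s j \<circ> ?s i" if "i \<in> set as \<union> set bs" for i
    proof -
      have i: "i \<in> set ms" "i \<noteq> t" "i \<noteq> j" using that m bs ms by auto
      show ?thesis by (rule simple_refl_commute) (use i only[OF i(1)] in blast)+
    qed
    have ca: "?p as \<circ> ?s j = ?s j \<circ> ?p as" and cb: "?p bs \<circ> ?s j = ?s j \<circ> ?p bs"
      by (rule word_prod_commute, rule nc, simp)+
    have br: "?s j \<circ> ?s t \<circ> ?s j = ?s t \<circ> ?s j \<circ> ?s t"
      using adj simple_refl_braid by metis
    have "?p (us @ as @ [t, j, t] @ bs @ vs) = w"
      unfolding w[symmetric]
      by (simp add: m fun_eq_iff word_prod_append word_prod_Cons word_prod_Nil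
          fun_cong[OF ca[symmetric], simplified] fun_cong[OF cb, simplified] fun_cong[OF br, simplified])
    then have "mset (us @ [j] @ ms @ [j] @ vs) = mset (us @ as @ [t, j, t] @ bs @ vs)"
      by (intro fully_commutative_mset_eq[OF fc red]) (use sub m in auto)
    then have "count (mset [j, j]) j = count (mset [t, j]) j"
      by (simp add: m)
    then show False using adj by (auto split: if_splits)
  qed
qed

text \<open>
  By induction on the gap: if one of the two neighbours of \<open>j\<close> is missing, the other neighbour \<open>t\<close>
  occurs twice. Two consecutive \<open>t\<close> enclose both neighbours of \<open>t\<close>, one of which is \<open>j\<close>.
\<close>

lemma between_consecutive_occurrences:
  assumes fc: "fully_commutative n w"
  shows "reduced_expr n w (us @ [j] @ ms @ [j] @ vs) \<Longrightarrow> j \<notin> set ms \<Longrightarrow>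
    Suc j \<in> set ms \<and> (\<exists>i \<in> set ms. j = Suc i)"
proof (induction "length ms" arbitrary: us j ms vs rule: less_induct)
  case less
  show ?case
  proof (rule ccontr)
    assume neg: "\<not> (Suc j \<in> set ms \<and> (\<exists>i \<in> set ms. j = Suc i))"
    define t where "t = (if Suc j \<in> set ms then Suc j else if j = 0 then 1 else j - 1)"
    have adj: "t = Suc j \<or> j = Suc t" by (auto simp: t_def)
    have only: "i \<in> set ms \<Longrightarrow> i = Suc j \<or> j = Suc i \<Longrightarrow> i = t" for i
      using neg by (auto simp: t_def)
    have "2 \<le> count_list ms t"
      using neighbour_occurs_twice[OF fc less.prems(1) adj less.prems(2) only] by blast
    then obtain as bs cs where m: "ms = as @ [t] @ bs @ [t] @ cs" "t \<notin> set bs"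
      by (rule split_two_occurrences)
    have "Suc t \<in> set bs \<and> (\<exists>i \<in> set bs. t = Suc i)"
    proof (rule less.hyps)
      show "reduced_expr n w ((us @ [j] @ as) @ [t] @ bs @ [t] @ (cs @ [j] @ vs))"
        using less.prems(1) m(1) by simp
    qed (use m in auto)
    then have "j \<in> set bs" using adj by auto
    then show False using less.prems(2) m(1) by auto
  qed
qed

text \<open>
  A word of simple reflections is a Temperley-Lieb diagram read from left to right, in which the
  letter \<open>j\<close> is an arc joining the positions \<open>j\<close>, \<open>j + 1\<close> on its left and another arc joining them
  on its right. Only the strands that start at a position on the right boundary are recorded: each
  of them ends at a position on the left or on the right boundary.
\<close>

datatype strand_end = Left nat | Right nat

definition attach_letter :: "nat \<Rightarrow> (nat \<Rightarrow> strand_end) \<Rightarrow> nat \<Rightarrow> strand_end" where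
  "attach_letter j \<pi> = (\<lambda>m.
     if m = j then Right (Suc j) else if m = Suc j then Right j
     else if \<pi> m = Right j then \<pi> (Suc j) else if \<pi> m = Right (Suc j) then \<pi> j else \<pi> m)"

definition tl_diagram :: "nat list \<Rightarrow> nat \<Rightarrow> strand_end" where
  "tl_diagram us = foldl (\<lambda>\<pi> j. attach_letter j \<pi>) Left us"

lemma tl_diagram_snoc: "tl_diagram (us @ [j]) = attach_letter j (tl_diagram us)"
  by (simp add: tl_diagram_def)

definition last_over :: "nat \<Rightarrow> nat \<Rightarrow> nat list \<Rightarrow> bool" where
  "last_over a b us \<longleftrightarrow> (\<exists>xs ys. us = xs @ [a] @ ys \<and> a \<notin> set ys \<and> b \<notin> set ys)"

lemma last_over_snoc:
  "last_over a b us \<Longrightarrow> j \<noteq> a \<Longrightarrow> j \<noteq> b \<Longrightarrow> last_over a b (us @ [j])"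
  by (fastforce simp: last_over_def)

lemma last_over_last: "last_over j b (us @ [j])"
  by (fastforce simp: last_over_def)

text \<open>
  The part of full commutativity that matters for the strands: consecutive occurrences of a letter
  enclose both of its neighbours.
\<close>

definition spread_word :: "nat list \<Rightarrow> bool" where
  "spread_word ws \<longleftrightarrow> 0 \<notin> set ws \<and>
     (\<forall>us j ms vs. ws = us @ [j] @ ms @ [j] @ vs \<longrightarrow> j \<notin> set ms \<longrightarrow> Suc j \<in> set ms \<and> j - 1 \<in> set ms)"

lemma fully_commutative_spread:
  assumes "fully_commutative n w" "reduced_expr n w ws"
  shows "spread_word ws"
  unfolding spread_word_def
proof (intro conjI allI impI)
  show "0 \<notin> set ws" using assms(2) by (auto simp: reduced_expr_def)
next
  fix us j ms vs
  assume "ws = us @ [j] @ ms @ [j] @ vs" "j \<notin> set ms"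
  then have "Suc j \<in> set ms \<and> (\<exists>i \<in> set ms. j = Suc i)"
    using between_consecutive_occurrences[OF assms(1)] assms(2) by blast
  then show "Suc j \<in> set ms" "j - 1 \<in> set ms" by auto
qed

lemma spread_word_prefix: "spread_word (us @ vs) \<Longrightarrow> spread_word us"
  unfolding spread_word_def
proof (intro conjI allI impI; (elim conjE)?)
  fix xs j ms ys
  assume us: "us = xs @ [j] @ ms @ [j] @ ys" "j \<notin> set ms"
    and all: "\<forall>xs j ms ys. us @ vs = xs @ [j] @ ms @ [j] @ ys \<longrightarrow> j \<notin> set ms \<longrightarrow>
      Suc j \<in> set ms \<and> j - 1 \<in> set ms"
  show "Suc j \<in> set ms" "j - 1 \<in> set ms"
    using all[rule_format, of xs j ms "ys @ vs"] us by simp_all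
qed simp

lemma spread_word_snoc:
  assumes "spread_word (us @ [j])"
  shows "\<not> last_over j (j - 1) us" "\<not> last_over j (Suc j) us"
proof -
  have "Suc j \<in> set ys \<and> j - 1 \<in> set ys" if "us = xs @ [j] @ ys" "j \<notin> set ys" for xs ys
    using assms that unfolding spread_word_def by (elim conjE allE[of _ xs] allE[of _ j] allE[of _ ys] allE[of _ "[]"]) simp
  then show "\<not> last_over j (j - 1) us" "\<not> last_over j (Suc j) us"
    unfolding last_over_def by blast+
qed

text \<open>
  In a fully commutative word a strand that turns at the letter \<open>q\<close> next turns at \<open>q - 1\<close> if it
  moved down, and at \<open>q + 1\<close> if it moved up, because it meets that letter before the next \<open>q\<close>.
  So strands never change direction. For a strand with both ends on the right boundary, what has to
  be remembered of this is its first turn at either end: the lower end turns upwards, the upper end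
  downwards.
\<close>

definition monotone_strands :: "nat list \<Rightarrow> (nat \<Rightarrow> strand_end) \<Rightarrow> bool" where
  "monotone_strands us \<pi> \<longleftrightarrow>
     (\<forall>m m'. \<pi> m = Right m' \<longrightarrow> \<pi> m' = Right m \<and> m \<noteq> m' \<and>
        (if m < m' then last_over m (m - 1) us else last_over (m - 1) m us))"

text \<open>
  A strand leaving the position \<open>j\<close> upwards would turn at a letter \<open>j\<close> that is followed by no
  \<open>j - 1\<close>, and then \<open>j\<close> could not be appended; similarly for \<open>j + 1\<close>.
\<close>

lemma monotone_strands_at_new_letter:
  assumes sp: "spread_word (us @ [j])" and mono: "monotone_strands us \<pi>"
  shows "\<pi> j = Right q \<Longrightarrow> q < j" "\<pi> (Suc j) = Right q \<Longrightarrow> Suc j < q"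
proof -
  assume "\<pi> j = Right q"
  then have "j \<noteq> q" "j < q \<Longrightarrow> last_over j (j - 1) us"
    using mono[unfolded monotone_strands_def, rule_format, of j q] by simp_all
  then show "q < j" using spread_word_snoc(1)[OF sp] by linarith
next
  assume "\<pi> (Suc j) = Right q"
  then have "Suc j \<noteq> q" "\<not> Suc j < q \<Longrightarrow> last_over j (Suc j) us"
    using mono[unfolded monotone_strands_def, rule_format, of "Suc j" q] by simp_all
  then show "Suc j < q" using spread_word_snoc(2)[OF sp] by blast
qed

lemma monotone_strands_attach:
  assumes sp: "spread_word (us @ [j])" and mono: "monotone_strands us \<pi>"
  shows "monotone_strands (us @ [j]) (attach_letter j \<pi>)"
  unfolding monotone_strands_def
proof (intro allI impI)
  fix m m' assume a: "attach_letter j \<pi> m = Right m'"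
  have j0: "j \<noteq> 0" using sp by (auto simp: spread_word_def)
  have J: "\<pi> m' = Right m" "m \<noteq> m'" "m < m' \<Longrightarrow> last_over m (m - 1) us" 
      "\<not> m < m' \<Longrightarrow> last_over (m - 1) m us"
    if "\<pi> m = Right m'" for m m'
    using mono[unfolded monotone_strands_def, rule_format, OF that] by simp_all
  note new = monotone_strands_at_new_letter[OF sp mono]
  note snoc = last_over_snoc[of _ _ us j]
  consider "m = j" | "m = Suc j" | "m \<noteq> j" "m \<noteq> Suc j" "\<pi> m = Right j" "\<pi> (Suc j) = Right m'"
    | "m \<noteq> j" "m \<noteq> Suc j" "\<pi> m = Right (Suc j)" "\<pi> j = Right m'"
    | "m \<noteq> j" "m \<noteq> Suc j" "\<pi> m = Right m'" "m' \<noteq> j" "m' \<noteq> Suc j"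
    using a by (auto simp: attach_letter_def split: if_splits)
  then show "attach_letter j \<pi> m' = Right m \<and> m \<noteq> m' \<and>
      (if m < m' then last_over m (m - 1) (us @ [j]) else last_over (m - 1) m (us @ [j]))"
  proof cases
    case 1
    then show ?thesis using a by (auto simp: attach_letter_def last_over_last)
  next
    case 2
    then show ?thesis using a by (auto simp: attach_letter_def last_over_last)
  next
    case 3
    then have "m < j" "Suc j < m'" "\<pi> m' = Right (Suc j)" "\<pi> j = Right m"
      using new J by blast+
    then show ?thesis using 3 J(3)[OF 3(3)] j0
      by (auto simp: attach_letter_def intro!: snoc)
  next
    case 4
    then have "Suc j < m" "m' < j" "\<pi> m' = Right j" "\<pi> (Suc j) = Right m"
      using new J by blast+
    then show ?thesis using 4 J(4)[OF 4(3)] j0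
      by (auto simp: attach_letter_def intro!: snoc)
  next
    case 5
    then show ?thesis using J[OF 5(3)] j0
      by (auto simp: attach_letter_def intro!: snoc)
  qed
qed

lemma monotone_strands_tl_diagram: "spread_word us \<Longrightarrow> monotone_strands us (tl_diagram us)"
proof (induction us rule: rev_induct)
  case Nil
  show ?case by (simp add: monotone_strands_def tl_diagram_def)
next
  case (snoc j us)
  then show ?case using monotone_strands_attach spread_word_prefix by (metis tl_diagram_snoc)
qed

text \<open>
  The positions \<open>j\<close> and \<open>j + 1\<close> are not joined to each other when \<open>j\<close> is appended, which would close
  a loop in the diagram.
\<close>

lemma no_closed_loop:
  assumes "spread_word (us @ [j])"
  shows "tl_diagram us j = Right q \<Longrightarrow> q < j" "tl_diagram us (Suc j) = Right q \<Longrightarrow> Suc j < q"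
  using monotone_strands_at_new_letter[OF assms] monotone_strands_tl_diagram spread_word_prefix assms
  by blast+


section \<open>Weyl lines transverse to a simple reflection\<close>

abbreviation V_simple :: "nat \<Rightarrow> nat \<Rightarrow> 'k::field_char_0 point set" where
  "V_simple n i \<equiv> transverse_union n (simple_refl i)"

text \<open>
  Weyl lines correspond to the partitions of the coordinates into two nonempty blocks. The union of
  those that are transverse to \<open>s\<^sub>i\<close> consists of the origin and the vectors with two values that
  \<open>s\<^sub>i\<close> exchanges.
\<close>

definition two_valued :: "nat \<Rightarrow> nat \<Rightarrow> 'k::field_char_0 point set" where
  "two_valued n i = {v \<in> geom_rep n. v = (\<lambda>_. 0) \<or>
     (v i \<noteq> v (Suc i) \<and> (\<forall>k \<in> {1..n+1}. v k = v i \<or> v k = v (Suc i)))}"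

lemma act_transpose: "act (transpose a b) v = (\<lambda>l. v (transpose a b l))"
  by (simp add: act_def inv_transpose_eq)

lemma mem_refl_hyperplane:
  "v \<in> refl_hyperplane n (transpose a b) \<longleftrightarrow> v \<in> geom_rep n \<and> v a = v b"
proof -
  have "(\<lambda>l. v (transpose a b l)) = v \<longleftrightarrow> v a = v b"
    by (auto simp: fun_eq_iff transpose_def)
  then show ?thesis by (simp add: refl_hyperplane_def act_transpose)
qed

lemma sum_two_cases:
  assumes "finite I" "A \<subseteq> I" "B \<subseteq> I" "A \<inter> B = {}"
  shows "(\<Sum>l\<in>I. if l \<in> A then x else if l \<in> B then y else (0::'k::field_char_0)) =
    of_nat (card A) * x + of_nat (card B) * y"
proof -
  have "(\<Sum>l\<in>I. if l \<in> A then x else if l \<in> B then y else 0) =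
    (\<Sum>l\<in>I. (if l \<in> A then x else 0) + (if l \<in> B then y else 0))"
    using assms(4) by (intro sum.cong) auto
  also have "\<dots> = (\<Sum>l\<in>I \<inter> A. x) + (\<Sum>l\<in>I \<inter> B. y)"
    using assms(1) by (simp only: sum.distrib sum.inter_restrict)
  finally show ?thesis using assms(2,3) by (simp add: Int_absorb1)
qed

text \<open>
  A vector that is constant on the level sets of \<open>w\<close> and has coordinate sum zero lies on the line of
  \<open>w\<close>. Balancing the level sets of \<open>w a\<close> and \<open>w b\<close> against each other gives such a vector which vanishes
  on every other level set.
\<close>

lemma third_value_zero:
  fixes w :: "'k::field_char_0 point"
  assumes A: "A \<subseteq> reflections n"
    and L: "{(\<lambda>i. c * w i) |c. True} = geom_rep n \<inter> (\<Inter>t\<in>A. refl_hyperplane n t)"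
    and ab: "a \<in> {1..n+1}" "b \<in> {1..n+1}" "w a \<noteq> w b" and d: "w d \<noteq> w a" "w d \<noteq> w b"
  shows "w d = 0"
proof -
  let ?A = "{l \<in> {1..n+1}. w l = w a}" and ?B = "{l \<in> {1..n+1}. w l = w b}"
  define u :: "'k point" where
    "u = (\<lambda>l. if l \<in> ?A then of_nat (card ?B) else if l \<in> ?B then - of_nat (card ?A) else 0)"
  have "(\<Sum>l=1..n+1. u l) = 0"
    unfolding u_def using ab by (subst sum_two_cases) auto
  then have geom: "u \<in> geom_rep n" by (auto simp: geom_rep_def u_def)
  have "w = (\<lambda>i. 1 * w i)" by simp
  then have w: "w \<in> geom_rep n \<inter> (\<Inter>t\<in>A. refl_hyperplane n t)" using L by blast
  have "u \<in> refl_hyperplane n t" if t: "t \<in> A" for t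
  proof -
    obtain x y where xy: "t = transpose x y" "x \<in> {1..n+1}" "y \<in> {1..n+1}"
      using t A by (auto simp: reflections_def)
    then have "w x = w y" using w t by (auto simp: mem_refl_hyperplane)
    then show ?thesis using geom xy by (simp add: mem_refl_hyperplane u_def)
  qed
  then have "u \<in> {(\<lambda>i. c * w i) |c. True}" using geom L by blast
  then obtain c where c: "u = (\<lambda>i. c * w i)" by blast
  have "b \<in> ?B" using ab by simp
  then have "card ?B \<noteq> 0" by (subst card_0_eq) auto
  then have "u a \<noteq> 0" using ab by (simp add: u_def)
  moreover have "u d = 0" using d by (simp add: u_def)
  ultimately show ?thesis by (simp add: c)
qed

lemma transverse_line_two_valued:
  assumes i: "1 \<le> i" "i \<le> n" and L: "L \<in> weyl_lines n" "transverse n L (simple_refl i)" and v: "v \<in> L"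
  shows "v \<in> two_valued n i"
proof -
  obtain w A where w: "L = {(\<lambda>i. c * w i) |c. True}" and A: "A \<subseteq> reflections n"
    and LA: "L = geom_rep n \<inter> (\<Inter>t\<in>A. refl_hyperplane n t)"
    using L(1) unfolding weyl_lines_def one_dimensional_def by blast
  note third = third_value_zero[OF A, of w, folded w, OF LA]
  have ir: "i \<in> {1..n+1}" "Suc i \<in> {1..n+1}" using i by auto
  have ne: "w i \<noteq> w (Suc i)"
  proof
    assume "w i = w (Suc i)"
    then have "x i = x (Suc i) \<and> x \<in> geom_rep n" if x: "x \<in> L" for x
    proof -
      obtain c where "x = (\<lambda>i. c * w i)" using x w by blast
      then show ?thesis using x LA \<open>w i = w (Suc i)\<close> by simp
    qed
    then have "L \<subseteq> refl_hyperplane n (simple_refl i)"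
      by (auto simp: simple_refl_def mem_refl_hyperplane)
    then show False using L(2) by (simp add: transverse_def)
  qed
  have two: "w k = w i \<or> w k = w (Suc i)" if k: "k \<in> {1..n+1}" for k
  proof (rule ccontr)
    assume neq: "\<not> (w k = w i \<or> w k = w (Suc i))"
    \<comment> \<open>With three values, each choice of two of them forces the remaining one to vanish.\<close>
    then have "w k = 0" "w i = 0"
      using third[OF ir ne, of k] third[OF ir(2) k, of i] ne by auto
    then show False using neq by simp
  qed
  obtain c where c: "v = (\<lambda>i. c * w i)" using v w by blast
  have "v \<in> geom_rep n" using v LA by blast
  moreover have "v = (\<lambda>_. 0) \<or> c \<noteq> 0" by (auto simp: c)
  moreover have "\<forall>k \<in> {1..n+1}. w k = w i \<or> w k = w (Suc i)" using two by blast
  ultimately show ?thesis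
    using ne by (auto simp: two_valued_def c)
qed

lemma two_valued_on_transverse_line:
  fixes v :: "'k::field_char_0 point"
  assumes i: "1 \<le> i" "i \<le> n" and v: "v \<in> two_valued n i" "v \<noteq> (\<lambda>_. 0)"
  shows "{(\<lambda>i. c * v i) |c. True} \<in> weyl_lines n"
    and "transverse n {(\<lambda>i. c * v i) |c. True} (simple_refl i)"
proof -
  let ?L = "{(\<lambda>i. c * v i) |c. True}"
  define A where "A = {transpose a b |a b. a \<in> {1..n+1} \<and> b \<in> {1..n+1} \<and> a \<noteq> b \<and> v a = v b}"
  have geom: "v \<in> geom_rep n" and ne: "v i \<noteq> v (Suc i)"
    and two: "k \<in> {1..n+1} \<Longrightarrow> v k = v i \<or> v k = v (Suc i)" for k
    using v by (auto simp: two_valued_def)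
  have ir: "i \<in> {1..n+1}" "Suc i \<in> {1..n+1}" using i by auto
  have scale: "(\<lambda>i. c * v i) \<in> geom_rep n" for c
    using geom sum_distrib_left[of c v "{1..n+1}"] by (auto simp: geom_rep_def)
  have "u \<in> ?L" if u: "u \<in> geom_rep n" "\<forall>t\<in>A. u \<in> refl_hyperplane n t" for u
  proof -
    have eq: "u a = u b" if "a \<in> {1..n+1}" "b \<in> {1..n+1}" "v a = v b" for a b
    proof (cases "a = b")
      case False
      then have "transpose a b \<in> A" using that by (auto simp: A_def)
      then show ?thesis using u(2) by (auto simp: mem_refl_hyperplane)
    qed simp
    \<comment> \<open>On the coordinates \<open>u\<close> is an affine function \<open>c v + d\<close> of \<open>v\<close>; the sum condition gives \<open>d = 0\<close>.\<close>
    define c where "c = (u i - u (Suc i)) / (v i - v (Suc i))"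
    define d where "d = u i - c * v i"
    have c: "c * v i - c * v (Suc i) = u i - u (Suc i)"
      unfolding right_diff_distrib[symmetric] using ne by (simp add: c_def)
    have ud: "u k = c * v k + d" if k: "k \<in> {1..n+1}" for k
      using two[OF k] eq[OF k ir(1)] eq[OF k ir(2)] c by (auto simp: d_def algebra_simps)
    have "0 = (\<Sum>k=1..n+1. c * v k + d)"
      using u(1) ud by (simp add: geom_rep_def)
    also have "\<dots> = c * (\<Sum>k=1..n+1. v k) + of_nat (n + 1) * d"
      unfolding sum.distrib sum_distrib_left by simp
    also have "\<dots> = of_nat (n + 1) * d" using geom by (simp add: geom_rep_def)
    finally have "d = 0" by (metis mult_eq_0_iff of_nat_eq_0_iff add_is_0 zero_neq_one)
    then have "u = (\<lambda>k. c * v k)"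
      using ud u(1) geom by (auto simp: geom_rep_def fun_eq_iff) (metis mult_zero_right)
    then show ?thesis by blast
  qed
  moreover have "?L \<subseteq> geom_rep n \<inter> (\<Inter>t\<in>A. refl_hyperplane n t)"
    using scale by (auto simp: A_def mem_refl_hyperplane)
  ultimately have "?L = geom_rep n \<inter> (\<Inter>t\<in>A. refl_hyperplane n t)" by blast
  moreover have "A \<subseteq> reflections n" by (auto simp: A_def reflections_def)
  moreover have "one_dimensional ?L" using v(2) by (auto simp: one_dimensional_def)
  ultimately show "?L \<in> weyl_lines n" unfolding weyl_lines_def by blast
  have "v = (\<lambda>i. 1 * v i)" by simp
  then have "v \<in> ?L" by blast
  moreover have "v \<notin> refl_hyperplane n (simple_refl i)"
    using ne by (simp add: simple_refl_def mem_refl_hyperplane)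
  ultimately show "transverse n ?L (simple_refl i)" by (auto simp: transverse_def)
qed

text \<open>
  A point with one value on all odd and another value on all even coordinates is transverse to every
  simple reflection. It lies on all the varieties occurring in a product of the bimodules \<open>B\<^sub>i\<close>, and
  evaluating there shows that the product does not vanish.
\<close>

definition alternating_point :: "nat \<Rightarrow> 'k::field_char_0 point" where
  "alternating_point n = (\<lambda>l. if l \<in> {l \<in> {1..n+1}. odd l} then of_nat (card {l \<in> {1..n+1}. even l})
     else if l \<in> {l \<in> {1..n+1}. even l} then - of_nat (card {l \<in> {1..n+1}. odd l}) else 0)"

lemma alternating_point_two_valued:
  assumes i: "1 \<le> i" "i \<le> n"
  shows "(alternating_point n :: 'k::field_char_0 point) \<in> two_valued n i"
    and "(alternating_point n :: 'k point) \<noteq> (\<lambda>_. 0)"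
proof -
  let ?v = "alternating_point n :: 'k point"
  let ?p = "card {l \<in> {1..n+1}. odd l}" and ?q = "card {l \<in> {1..n+1}. even l}"
  have "(\<Sum>l=1..n+1. ?v l) = 0"
    unfolding alternating_point_def by (subst sum_two_cases) auto
  then have geom: "?v \<in> geom_rep n" by (auto simp: geom_rep_def alternating_point_def)
  have "1 \<in> {l \<in> {1..n+1}. odd l}" by simp
  then have "?p \<noteq> 0" by (subst card_0_eq) auto
  then have "of_nat (?q + ?p) \<noteq> (0 :: 'k)" by (metis add_is_0 of_nat_eq_0_iff)
  then have pq: "of_nat ?q \<noteq> - (of_nat ?p :: 'k)" by (simp add: eq_neg_iff_add_eq_0)
  have odd: "?v l = of_nat ?q" if "l \<in> {1..n+1}" "odd l" for l
    using that by (simp add: alternating_point_def)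
  have even: "?v l = - of_nat ?p" if "l \<in> {1..n+1}" "even l" for l
    using that by (simp add: alternating_point_def)
  have ir: "i \<in> {1..n+1}" "Suc i \<in> {1..n+1}" using i by auto
  have vi: "?v i = (if odd i then of_nat ?q else - of_nat ?p)"
    "?v (Suc i) = (if odd i then - of_nat ?p else of_nat ?q)"
    using odd[OF ir(1)] even[OF ir(1)] odd[OF ir(2)] even[OF ir(2)] by simp_all
  have ne: "?v i \<noteq> ?v (Suc i)" unfolding vi using pq by (metis (full_types))
  have "?v k = ?v i \<or> ?v k = ?v (Suc i)" if "k \<in> {1..n+1}" for k
    unfolding vi using odd[OF that] even[OF that] by (cases "odd k") auto
  then show "?v \<in> two_valued n i" using geom ne unfolding two_valued_def by blast
  show "?v \<noteq> (\<lambda>_. 0)" using ne by (metis (no_types))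
qed

lemma V_simple_eq_two_valued:
  assumes i: "1 \<le> i" "i \<le> n"
  shows "V_simple n i = (two_valued n i :: 'k::field_char_0 point set)"
proof
  show "V_simple n i \<subseteq> (two_valued n i :: 'k point set)"
    using transverse_line_two_valued[OF i] by (auto simp: transverse_union_def)
  show "(two_valued n i :: 'k point set) \<subseteq> V_simple n i"
  proof
    fix v :: "'k point" assume v: "v \<in> two_valued n i"
    \<comment> \<open>The origin lies on every line, so any transverse line serves for it.\<close>
    define w where "w = (if v = (\<lambda>_. 0) then alternating_point n else v)"
    have w: "w \<in> two_valued n i" "w \<noteq> (\<lambda>_. 0)"
      using v alternating_point_two_valued[OF i] by (auto simp: w_def)
    have "v = (\<lambda>l. (if v = (\<lambda>_. 0) then 0 else 1) * w l)" by (auto simp: w_def)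
    then have "v \<in> {(\<lambda>i. c * w i) |c. True}" by blast
    then show "v \<in> V_simple n i"
      using two_valued_on_transverse_line[OF i w] by (auto simp: transverse_union_def)
  qed
qed

lemma alternating_point_in_V_simple:
  assumes "1 \<le> i" "i \<le> n"
  shows "alternating_point n \<in> V_simple n i"
  using alternating_point_two_valued(1)[OF assms] V_simple_eq_two_valued[OF assms] by blast

lemma V_simple_subset: "V_simple n i \<subseteq> weyl_lines_union n"
  by (auto simp: transverse_union_def weyl_lines_union_def)

text \<open>
  Both sides are the sum of the two values of the coordinates of \<open>v\<close>.
\<close>

lemma two_values_sum_eq:
  assumes i: "1 \<le> i" "i \<le> n" and j: "1 \<le> j" "j \<le> n"
    and v: "v \<in> V_simple n i" "v \<in> V_simple n j"
  shows "v i + v (Suc i) = v j + v (Suc j)"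
proof -
  have "i \<in> {1..n+1}" "Suc i \<in> {1..n+1}" "j \<in> {1..n+1}" "Suc j \<in> {1..n+1}" using i j by auto
  moreover have "v = (\<lambda>_. 0) \<or> (v i \<noteq> v (Suc i) \<and> v j \<noteq> v (Suc j) \<and>
      (\<forall>k \<in> {1..n+1}. v k = v i \<or> v k = v (Suc i)))"
    using v unfolding V_simple_eq_two_valued[OF i] V_simple_eq_two_valued[OF j] two_valued_def
    by blast
  ultimately have "v = (\<lambda>_. 0) \<or> (v j = v i \<and> v (Suc j) = v (Suc i)) \<or>
      (v j = v (Suc i) \<and> v (Suc j) = v i)"
    by metis
  then show ?thesis by (auto simp: add.commute)
qed

lemma act_simple_refl: "act (simple_refl i) v = v \<circ> transpose i (Suc i)"
  by (simp add: simple_refl_def act_transpose o_def)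

lemma V_simple_act:
  assumes i: "1 \<le> i" "i \<le> n" and v: "v \<in> V_simple n i"
  shows "act (simple_refl i) v \<in> V_simple n i"
proof -
  have vt: "v \<in> two_valued n i" using v V_simple_eq_two_valued[OF i] by blast
  have p: "transpose i (Suc i) permutes {1..n+1}"
    using i by (intro permutes_swap_id) auto
  have "(\<Sum>l=1..n+1. (v \<circ> transpose i (Suc i)) l) = (\<Sum>l=1..n+1. v l)"
    using sum.permute[OF p, of v] by simp
  moreover have "(v \<circ> transpose i (Suc i)) l = 0" if "l \<notin> {1..n+1}" for l
  proof -
    have "l \<noteq> i" "l \<noteq> Suc i" using that i by auto
    then show ?thesis using that vt by (auto simp: two_valued_def geom_rep_def)
  qed
  ultimately have geom: "v \<circ> transpose i (Suc i) \<in> geom_rep n"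
    using vt by (simp add: two_valued_def geom_rep_def)
  have "v \<circ> transpose i (Suc i) \<in> two_valued n i"
  proof (cases "v = (\<lambda>_. 0)")
    case True
    then show ?thesis using vt by (simp add: o_def)
  next
    case False
    define u where "u = v \<circ> transpose i (Suc i)"
    have ui: "u i = v (Suc i)" "u (Suc i) = v i" by (simp_all add: u_def)
    have "u i \<noteq> u (Suc i)" using False vt unfolding ui by (auto simp: two_valued_def)
    moreover have "u k = u i \<or> u k = u (Suc i)" if "k \<in> {1..n+1}" for k
    proof -
      have "transpose i (Suc i) k \<in> {1..n+1}" using that permutes_in_image[OF p] by blast
      then show ?thesis using False vt unfolding ui by (auto simp: two_valued_def u_def)
    qed
    ultimately show ?thesis using geom unfolding two_valued_def u_def by blast
  qed
  then show ?thesis using V_simple_eq_two_valued[OF i] by (auto simp: act_simple_refl)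
qed

lemma poly_fun_diff:
  assumes "p \<in> poly_fun" "q \<in> poly_fun"
  shows "(\<lambda>v. p v - q v) \<in> poly_fun"
proof -
  have "(\<lambda>v. p v + (- 1) * q v) \<in> poly_fun"
    using assms by (intro poly_fun.intros)
  then show ?thesis by simp
qed

text \<open>
  The set \<open>V\<^sub>i\<close> is cut out by the functions \<open>(x\<^sub>k - x\<^sub>i) (x\<^sub>k - x\<^sub>i\<^sub>+\<^sub>1)\<close>: at a point of \<open>Z\<close> outside \<open>V\<^sub>i\<close>
  one has \<open>x\<^sub>i = x\<^sub>i\<^sub>+\<^sub>1\<close>, and some further coordinate differs from them.
\<close>

lemma V_simple_zero_locus:
  assumes i: "1 \<le> i" "i \<le> n" and z: "z \<in> weyl_lines_union n"
    and vanish: "\<And>r. r \<in> carrier (Rbar n) \<Longrightarrow> (\<And>v. v \<in> V_simple n i \<Longrightarrow> r v = 0) \<Longrightarrow> r z = 0"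
  shows "z \<in> V_simple n i"
proof (rule ccontr)
  assume nV: "z \<notin> V_simple n i"
  obtain L where L: "L \<in> weyl_lines n" "z \<in> L" using z by (auto simp: weyl_lines_union_def)
  have "L \<subseteq> refl_hyperplane n (simple_refl i)"
    using L nV by (auto simp: transverse_union_def transverse_def)
  then have zi: "z i = z (Suc i)" and geom: "z \<in> geom_rep n"
    using L(2) mem_refl_hyperplane[of z n i "Suc i"] by (auto simp: simple_refl_def)
  have "z \<noteq> (\<lambda>_. 0)"
    using nV geom V_simple_eq_two_valued[OF i] by (auto simp: two_valued_def)
  have "z k = z i" if k: "k \<in> {1..n+1}" for k
  proof -
    define q where "q = (\<lambda>v. (v k - v i) * (v k - v (Suc i)) :: 'a)"
    have "q \<in> poly_fun" unfolding q_def by (intro poly_fun.intros poly_fun_diff)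
    then have "restr (weyl_lines_union n) q \<in> carrier (Rbar n)"
      by (simp add: Rbar_def regular_ring_def)
    moreover have "restr (weyl_lines_union n) q v = 0" if "v \<in> V_simple n i" for v
      using that k by (auto simp: V_simple_eq_two_valued[OF i] two_valued_def restr_def q_def)
    ultimately have "restr (weyl_lines_union n) q z = 0" by (rule vanish)
    then show ?thesis using z zi by (simp add: restr_def q_def)
  qed
  then have "(\<Sum>k=1..n+1. z k) = of_nat (n + 1) * z i" by simp
  then have "z i = 0"
    using geom by (metis (mono_tags, lifting) geom_rep_def mem_Collect_eq mult_eq_0_iff of_nat_eq_0_iff add_is_0 zero_neq_one)
  then have "z = (\<lambda>_. 0)"
    using \<open>\<And>k. k \<in> {1..n+1} \<Longrightarrow> z k = z i\<close> geom by (auto simp: geom_rep_def fun_eq_iff)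
  then show False using \<open>z \<noteq> (\<lambda>_. 0)\<close> by simp
qed


section \<open>Bimodules and their tensor products\<close>

text \<open>
  The fragment of the bimodule axioms that passes to the formal tensor product and suffices for
  computing with a cyclic generator.
\<close>

locale bimodule =
  fixes R S :: "'r graded_ring" and M :: "('r, 'b) gbimod"
  assumes left_one_closed: "\<one>\<^bsub>R\<^esub> \<in> carrier R"
    and right_one_closed: "\<one>\<^bsub>S\<^esub> \<in> carrier S"
    and left_mult_closed: "\<lbrakk>r \<in> carrier R; r' \<in> carrier R\<rbrakk> \<Longrightarrow> r \<otimes>\<^bsub>R\<^esub> r' \<in> carrier R"
    and right_mult_closed: "\<lbrakk>s \<in> carrier S; s' \<in> carrier S\<rbrakk> \<Longrightarrow> s \<otimes>\<^bsub>S\<^esub> s' \<in> carrier S"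
    and zero_closed: "\<zero>\<^bsub>M\<^esub> \<in> carrier M"
    and add_closed: "\<lbrakk>x \<in> carrier M; y \<in> carrier M\<rbrakk> \<Longrightarrow> x \<oplus>\<^bsub>M\<^esub> y \<in> carrier M"
    and zero_add: "x \<in> carrier M \<Longrightarrow> \<zero>\<^bsub>M\<^esub> \<oplus>\<^bsub>M\<^esub> x = x"
    and smult_closed: "\<lbrakk>r \<in> carrier R; x \<in> carrier M\<rbrakk> \<Longrightarrow> smult M r x \<in> carrier M"
    and rsmult_closed: "\<lbrakk>s \<in> carrier S; x \<in> carrier M\<rbrakk> \<Longrightarrow> rsmult M x s \<in> carrier M"
    and smult_zero: "r \<in> carrier R \<Longrightarrow> smult M r \<zero>\<^bsub>M\<^esub> = \<zero>\<^bsub>M\<^esub>"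
    and rsmult_zero: "s \<in> carrier S \<Longrightarrow> rsmult M \<zero>\<^bsub>M\<^esub> s = \<zero>\<^bsub>M\<^esub>"
    and smult_add: "\<lbrakk>r \<in> carrier R; x \<in> carrier M; y \<in> carrier M\<rbrakk> \<Longrightarrow>
      smult M r (x \<oplus>\<^bsub>M\<^esub> y) = smult M r x \<oplus>\<^bsub>M\<^esub> smult M r y"
    and rsmult_add: "\<lbrakk>s \<in> carrier S; x \<in> carrier M; y \<in> carrier M\<rbrakk> \<Longrightarrow>
      rsmult M (x \<oplus>\<^bsub>M\<^esub> y) s = rsmult M x s \<oplus>\<^bsub>M\<^esub> rsmult M y s"
    and rsmult_smult: "\<lbrakk>r \<in> carrier R; s \<in> carrier S; x \<in> carrier M\<rbrakk> \<Longrightarrow>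
      rsmult M (smult M r x) s = smult M r (rsmult M x s)"
    and smult_smult: "\<lbrakk>r \<in> carrier R; r' \<in> carrier R; x \<in> carrier M\<rbrakk> \<Longrightarrow>
      smult M r (smult M r' x) = smult M (r \<otimes>\<^bsub>R\<^esub> r') x"
    and rsmult_rsmult: "\<lbrakk>s \<in> carrier S; s' \<in> carrier S; x \<in> carrier M\<rbrakk> \<Longrightarrow>
      rsmult M (rsmult M x s) s' = rsmult M x (s \<otimes>\<^bsub>S\<^esub> s')"
    and smult_one: "x \<in> carrier M \<Longrightarrow> smult M \<one>\<^bsub>R\<^esub> x = x"
    and rsmult_one: "x \<in> carrier M \<Longrightarrow> rsmult M x \<one>\<^bsub>S\<^esub> = x"

inductive_set generated :: "'r graded_ring \<Rightarrow> 'r graded_ring \<Rightarrow> ('r, 'b) gbimod \<Rightarrow> 'b \<Rightarrow> 'b set"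
  for R S M e where
  zero: "\<zero>\<^bsub>M\<^esub> \<in> generated R S M e"
| gen: "\<lbrakk>r \<in> carrier R; s \<in> carrier S\<rbrakk> \<Longrightarrow> smult M r (rsmult M e s) \<in> generated R S M e"
| add: "\<lbrakk>x \<in> generated R S M e; y \<in> generated R S M e\<rbrakk> \<Longrightarrow> x \<oplus>\<^bsub>M\<^esub> y \<in> generated R S M e"

text \<open>
  A fibre functional at the point \<open>v\<close>: both rings act on its values through their values at \<open>v\<close>.
\<close>

definition evaluation ::
  "('p \<Rightarrow> 'k::field) graded_ring \<Rightarrow> ('p \<Rightarrow> 'k) graded_ring \<Rightarrow> ('p \<Rightarrow> 'k, 'b) gbimod \<Rightarrow>
   'p \<Rightarrow> ('b \<Rightarrow> 'k) \<Rightarrow> bool" where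
  "evaluation R S M v \<epsilon> \<longleftrightarrow> \<epsilon> \<zero>\<^bsub>M\<^esub> = 0 \<and>
     (\<forall>x \<in> carrier M. \<forall>y \<in> carrier M. \<epsilon> (x \<oplus>\<^bsub>M\<^esub> y) = \<epsilon> x + \<epsilon> y) \<and>
     (\<forall>r \<in> carrier R. \<forall>x \<in> carrier M. \<epsilon> (smult M r x) = r v * \<epsilon> x) \<and>
     (\<forall>s \<in> carrier S. \<forall>x \<in> carrier M. \<epsilon> (rsmult M x s) = \<epsilon> x * s v)"

abbreviation pure_tensor ::
  "'r graded_ring \<Rightarrow> ('r, 'a tens) gbimod \<Rightarrow> ('r, 'a tens) gbimod \<Rightarrow> 'a tens \<Rightarrow> 'a tens \<Rightarrow> 'a tens"
  where "pure_tensor S M N x y \<equiv> tensor_class S M N {#(x, y)#}"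

context bimodule
begin

lemma generated_closed:
  assumes "e \<in> carrier M" "x \<in> generated R S M e"
  shows "x \<in> carrier M"
  using assms(2)
  by (induction rule: generated.induct)
    (blast intro: zero_closed smult_closed rsmult_closed add_closed assms(1))+

lemma generated_smult:
  assumes e: "e \<in> carrier M" and r: "r \<in> carrier R" and x: "x \<in> generated R S M e"
  shows "smult M r x \<in> generated R S M e"
  using x
proof (induction rule: generated.induct)
  case zero
  then show ?case using r by (simp add: smult_zero generated.zero)
next
  case (gen r' s)
  then show ?case using r e by (simp add: smult_smult rsmult_closed generated.gen left_mult_closed right_mult_closed)
next
  case (add x y)
  then show ?case
    using r e by (simp add: smult_add generated_closed generated.add)
qed

lemma generated_rsmult:
  assumes e: "e \<in> carrier M" and r: "s \<in> carrier S" and x: "x \<in> generated R S M e"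
  shows "rsmult M x s \<in> generated R S M e"
  using x
proof (induction rule: generated.induct)
  case zero
  then show ?case using r by (simp add: rsmult_zero generated.zero)
next
  case (gen r' s)
  then show ?case
    using r e by (simp add: rsmult_smult rsmult_rsmult rsmult_closed generated.gen left_mult_closed right_mult_closed)
next
  case (add x y)
  then show ?case
    using r e by (simp add: rsmult_add generated_closed generated.add)
qed

lemma generated_generator:
  assumes "e \<in> carrier M"
  shows "e \<in> generated R S M e"
  using generated.gen[OF left_one_closed right_one_closed, of M e]
  by (simp add: smult_one rsmult_one assms)

end

locale tensor_pair = left: bimodule R S M + right: bimodule S T N
  for R S T :: "'r graded_ring" and M N :: "('r, 'a tens) gbimod"
begin

lemma formal_sums_add: "\<lbrakk>u \<in> formal_sums M N; v \<in> formal_sums M N\<rbrakk> \<Longrightarrow> u + v \<in> formal_sums M N"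
  by (auto simp: formal_sums_def)

lemma formal_sums_empty: "{#} \<in> formal_sums M N"
  by (simp add: formal_sums_def)

lemma formal_sums_single: "\<lbrakk>x \<in> carrier M; y \<in> carrier N\<rbrakk> \<Longrightarrow> {#(x, y)#} \<in> formal_sums M N"
  by (simp add: formal_sums_def)

lemma formal_sums_smult:
  "r \<in> carrier R \<Longrightarrow> u \<in> formal_sums M N \<Longrightarrow> image_mset (\<lambda>(x, y). (smult M r x, y)) u \<in> formal_sums M N"
  by (auto simp: formal_sums_def intro: left.smult_closed)

lemma formal_sums_rsmult:
  "s \<in> carrier T \<Longrightarrow> u \<in> formal_sums M N \<Longrightarrow> image_mset (\<lambda>(x, y). (x, rsmult N y s)) u \<in> formal_sums M N"
  by (auto simp: formal_sums_def intro: right.rsmult_closed)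

lemma tensor_rel_formal_sums:
  "tensor_rel S M N u v \<Longrightarrow> u \<in> formal_sums M N \<and> v \<in> formal_sums M N"
  by (induction rule: tensor_rel.induct)
    (auto simp: formal_sums_def intro: left.zero_closed right.zero_closed left.add_closed
      right.add_closed left.rsmult_closed right.smult_closed)

lemma tensor_rel_smult:
  assumes "tensor_rel S M N u v" and r: "r \<in> carrier R"
  shows "tensor_rel S M N (image_mset (\<lambda>(x, y). (smult M r x, y)) u)
    (image_mset (\<lambda>(x, y). (smult M r x, y)) v)"
  using assms(1)
proof (induction rule: tensor_rel.induct)
  case (refl u)
  then show ?case using r by (intro tensor_rel.refl formal_sums_smult)
next
  case (sym u v)
  show ?case by (rule tensor_rel.sym[OF sym.IH])
next
  case (trans u v w)
  show ?case by (rule tensor_rel.trans[OF trans.IH])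
next
  case (cong u v w)
  then show ?case using tensor_rel.cong[OF cong.IH formal_sums_smult[OF r cong.hyps(2)]] by simp
qed (use r in \<open>simp_all add: left.smult_zero left.smult_add left.smult_closed left.zero_closed
    left.rsmult_smult[symmetric] tensor_rel.intros(5-9)\<close>)

lemma tensor_rel_rsmult:
  assumes "tensor_rel S M N u v" and s: "s \<in> carrier T"
  shows "tensor_rel S M N (image_mset (\<lambda>(x, y). (x, rsmult N y s)) u)
    (image_mset (\<lambda>(x, y). (x, rsmult N y s)) v)"
  using assms(1)
proof (induction rule: tensor_rel.induct)
  case (refl u)
  then show ?case using s by (intro tensor_rel.refl formal_sums_rsmult)
next
  case (sym u v)
  show ?case by (rule tensor_rel.sym[OF sym.IH])
next
  case (trans u v w)
  show ?case by (rule tensor_rel.trans[OF trans.IH])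
next
  case (cong u v w)
  then show ?case using tensor_rel.cong[OF cong.IH formal_sums_rsmult[OF s cong.hyps(2)]] by simp
qed (use s in \<open>simp_all add: right.rsmult_zero right.rsmult_add right.rsmult_closed right.zero_closed
    right.rsmult_smult tensor_rel.intros(5-9)\<close>)

lemma terms_tensor_class:
  assumes "u \<in> formal_sums M N"
  shows "tensor_rel S M N (terms (tensor_class S M N u)) u"
    and "terms (tensor_class S M N u) \<in> formal_sums M N"
proof -
  have "tensor_rel S M N u (SOME v. tensor_rel S M N u v)"
    by (rule someI) (rule tensor_rel.refl[OF assms])
  then show "tensor_rel S M N (terms (tensor_class S M N u)) u"
    by (simp add: tensor_class_def tensor_rel.sym)
  then show "terms (tensor_class S M N u) \<in> formal_sums M N"
    using tensor_rel_formal_sums by blast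
qed

lemma class_eqI: "tensor_rel S M N u v \<Longrightarrow> tensor_class S M N u = tensor_class S M N v"
  using tensor_rel_formal_sums tensor_class_eq_iff by blast

lemma class_add:
  assumes "u \<in> formal_sums M N" "v \<in> formal_sums M N"
  shows "tensor_class S M N u \<oplus>\<^bsub>tensor S M N\<^esub> tensor_class S M N v = tensor_class S M N (u + v)"
proof -
  let ?c = "\<lambda>u. terms (tensor_class S M N u)"
  have "tensor_rel S M N (?c u + ?c v) (u + ?c v)"
    by (intro tensor_rel.cong terms_tensor_class assms)
  moreover have "tensor_rel S M N (u + ?c v) (u + v)"
    using tensor_rel.cong[OF terms_tensor_class(1)[OF assms(2)] assms(1)] by (simp add: add.commute)
  ultimately have "tensor_rel S M N (?c u + ?c v) (u + v)" by (rule tensor_rel.trans)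
  from class_eqI[OF this] show ?thesis by (simp add: tensor_def)
qed

lemma class_smult:
  assumes "u \<in> formal_sums M N" "r \<in> carrier R"
  shows "smult (tensor S M N) r (tensor_class S M N u) =
    tensor_class S M N (image_mset (\<lambda>(x, y). (smult M r x, y)) u)"
  using class_eqI[OF tensor_rel_smult[OF terms_tensor_class(1)[OF assms(1)] assms(2)]]
  by (simp add: tensor_def)

lemma class_rsmult:
  assumes "u \<in> formal_sums M N" "s \<in> carrier T"
  shows "rsmult (tensor S M N) (tensor_class S M N u) s =
    tensor_class S M N (image_mset (\<lambda>(x, y). (x, rsmult N y s)) u)"
  using class_eqI[OF tensor_rel_rsmult[OF terms_tensor_class(1)[OF assms(1)] assms(2)]]
  by (simp add: tensor_def)

lemma tensor_carrier: "carrier (tensor S M N) = tensor_class S M N ` formal_sums M N"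
  and tensor_zero: "\<zero>\<^bsub>tensor S M N\<^esub> = tensor_class S M N {#}"
  by (simp_all add: tensor_def)

lemma bimodule_tensor: "bimodule R T (tensor S M N)"
proof -
  let ?T = "tensor S M N" and ?C = "tensor_class S M N" and ?F = "formal_sums M N"
  let ?l = "\<lambda>r. image_mset (\<lambda>(x, y). (smult M r x, y))"
  let ?r = "\<lambda>s. image_mset (\<lambda>(x, y). (x, rsmult N y s))"
  note ops = class_add class_smult class_rsmult tensor_zero
    formal_sums_add formal_sums_empty formal_sums_smult formal_sums_rsmult
  note ring = left.left_one_closed left.left_mult_closed right.right_one_closed right.right_mult_closed
  have mem: "x \<in> carrier M" "y \<in> carrier N" if "u \<in> ?F" "(x, y) \<in># u" for x y u
    using that by (auto simp: formal_sums_def)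
  have one: "?l \<one>\<^bsub>R\<^esub> u = u" "?r \<one>\<^bsub>T\<^esub> u = u" if u: "u \<in> ?F" for u
    using image_mset_cong[of u "\<lambda>(x, y). (smult M \<one>\<^bsub>R\<^esub> x, y)" id]
      image_mset_cong[of u "\<lambda>(x, y). (x, rsmult N y \<one>\<^bsub>T\<^esub>)" id]
    by (auto simp: left.smult_one right.rsmult_one mem[OF u])
  have left: "?l r (?l r' u) = ?l (r \<otimes>\<^bsub>R\<^esub> r') u"
    if "u \<in> ?F" "r \<in> carrier R" "r' \<in> carrier R" for r r' u
    unfolding image_mset.compositionality using that
    by (intro image_mset_cong) (auto simp: left.smult_smult mem)
  have right: "?r s' (?r s u) = ?r (s \<otimes>\<^bsub>T\<^esub> s') u"
    if "u \<in> ?F" "s \<in> carrier T" "s' \<in> carrier T" for s s' u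
    unfolding image_mset.compositionality using that
    by (intro image_mset_cong) (auto simp: right.rsmult_rsmult mem)
  have swap: "?r s (?l r u) = ?l r (?r s u)" for r s u
    unfolding image_mset.compositionality by (intro image_mset_cong) auto
  show ?thesis
    by unfold_locales (auto simp: tensor_carrier ops ring one left right swap)
qed

sublocale bimodule R T "tensor S M N"
  by (rule bimodule_tensor)

lemma pure_closed:
  "\<lbrakk>x \<in> carrier M; y \<in> carrier N\<rbrakk> \<Longrightarrow> pure_tensor S M N x y \<in> carrier (tensor S M N)"
  by (simp add: tensor_carrier formal_sums_single)

lemma tensor_induct [consumes 1, case_names zero pure add]:
  assumes "a \<in> carrier (tensor S M N)"
    and zero: "P \<zero>\<^bsub>tensor S M N\<^esub>"
    and pure: "\<And>x y. x \<in> carrier M \<Longrightarrow> y \<in> carrier N \<Longrightarrow> P (pure_tensor S M N x y)"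
    and add: "\<And>a b. a \<in> carrier (tensor S M N) \<Longrightarrow> b \<in> carrier (tensor S M N) \<Longrightarrow> P a \<Longrightarrow> P b \<Longrightarrow>
      P (a \<oplus>\<^bsub>tensor S M N\<^esub> b)"
  shows "P a"
proof -
  obtain u where "u \<in> formal_sums M N" "a = tensor_class S M N u"
    using assms(1) by (auto simp: tensor_carrier)
  moreover have "u \<in> formal_sums M N \<Longrightarrow> P (tensor_class S M N u)"
  proof (induction u)
    case empty
    then show ?case using zero by (simp add: tensor_zero)
  next
    case (add p u)
    obtain x y where p: "p = (x, y)" by (cases p)
    have xy: "x \<in> carrier M" "y \<in> carrier N" and u: "u \<in> formal_sums M N"
      using add.prems by (auto simp: formal_sums_def p)
    have "tensor_class S M N (add_mset p u) =
        tensor_class S M N u \<oplus>\<^bsub>tensor S M N\<^esub> pure_tensor S M N x y"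
      using u xy by (simp add: class_add formal_sums_single p)
    moreover have "tensor_class S M N u \<in> carrier (tensor S M N)"
      using u by (simp add: tensor_carrier)
    ultimately show ?case
      using add.IH[OF u] assms(3)[OF xy] assms(4) pure_closed[OF xy] by simp
  qed
  ultimately show ?thesis by simp
qed

lemma pure_zero_left: "y \<in> carrier N \<Longrightarrow> pure_tensor S M N \<zero>\<^bsub>M\<^esub> y = \<zero>\<^bsub>tensor S M N\<^esub>"
  by (simp add: tensor_zero class_eqI tensor_rel.zero_left)

lemma pure_zero_right: "x \<in> carrier M \<Longrightarrow> pure_tensor S M N x \<zero>\<^bsub>N\<^esub> = \<zero>\<^bsub>tensor S M N\<^esub>"
  by (simp add: tensor_zero class_eqI tensor_rel.zero_right)

lemma pure_add_left:
  assumes "x \<in> carrier M" "x' \<in> carrier M" "y \<in> carrier N"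
  shows "pure_tensor S M N (x \<oplus>\<^bsub>M\<^esub> x') y =
    pure_tensor S M N x y \<oplus>\<^bsub>tensor S M N\<^esub> pure_tensor S M N x' y"
  using class_eqI[OF tensor_rel.add_left[OF assms]] assms
  by (simp add: class_add formal_sums_single add_mset_commute)

lemma pure_add_right:
  assumes "x \<in> carrier M" "y \<in> carrier N" "y' \<in> carrier N"
  shows "pure_tensor S M N x (y \<oplus>\<^bsub>N\<^esub> y') =
    pure_tensor S M N x y \<oplus>\<^bsub>tensor S M N\<^esub> pure_tensor S M N x y'"
  using class_eqI[OF tensor_rel.add_right[OF assms]] assms
  by (simp add: class_add formal_sums_single add_mset_commute)

lemma pure_balanced:
  "\<lbrakk>x \<in> carrier M; s \<in> carrier S; y \<in> carrier N\<rbrakk> \<Longrightarrow>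
    pure_tensor S M N (rsmult M x s) y = pure_tensor S M N x (smult N s y)"
  by (intro class_eqI tensor_rel.balanced)

lemma smult_pure:
  "\<lbrakk>r \<in> carrier R; x \<in> carrier M; y \<in> carrier N\<rbrakk> \<Longrightarrow>
    smult (tensor S M N) r (pure_tensor S M N x y) = pure_tensor S M N (smult M r x) y"
  by (simp add: class_smult formal_sums_single)

lemma rsmult_pure:
  "\<lbrakk>s \<in> carrier T; x \<in> carrier M; y \<in> carrier N\<rbrakk> \<Longrightarrow>
    rsmult (tensor S M N) (pure_tensor S M N x y) s = pure_tensor S M N x (rsmult N y s)"
  by (simp add: class_rsmult formal_sums_single)

lemma smult_eq_zero:
  assumes r: "r \<in> carrier R" and "\<And>x. x \<in> carrier M \<Longrightarrow> smult M r x = \<zero>\<^bsub>M\<^esub>"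
    and "a \<in> carrier (tensor S M N)"
  shows "smult (tensor S M N) r a = \<zero>\<^bsub>tensor S M N\<^esub>"
  using assms(3)
  by (induction rule: tensor_induct)
    (simp_all add: r assms(2) smult_zero smult_add smult_pure pure_zero_left zero_add zero_closed)

lemma rsmult_eq_zero:
  assumes s: "s \<in> carrier T" and "\<And>y. y \<in> carrier N \<Longrightarrow> rsmult N y s = \<zero>\<^bsub>N\<^esub>"
    and "a \<in> carrier (tensor S M N)"
  shows "rsmult (tensor S M N) a s = \<zero>\<^bsub>tensor S M N\<^esub>"
  using assms(3)
  by (induction rule: tensor_induct)
    (simp_all add: s assms(2) rsmult_zero rsmult_add rsmult_pure pure_zero_right zero_add zero_closed)

lemma pure_grade:
  assumes "x \<in> grade M a" "y \<in> grade N b"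
  shows "pure_tensor S M N x y \<in> grade (tensor S M N) (a + b)"
  unfolding tensor_def using assms by (auto intro!: imageI exI[of _ a])

end

lemma evaluation_tensor:
  fixes R S T :: "('p \<Rightarrow> 'k::field) graded_ring"
  assumes "tensor_pair R S T M N" and \<epsilon>: "evaluation R S M v \<epsilon>" and \<delta>: "evaluation S T N v \<delta>"
  obtains \<gamma> where "evaluation R T (tensor S M N) v \<gamma>"
    and "\<And>x y. x \<in> carrier M \<Longrightarrow> y \<in> carrier N \<Longrightarrow> \<gamma> (pure_tensor S M N x y) = \<epsilon> x * \<delta> y"
proof -
  interpret tensor_pair R S T M N by fact
  define val where "val = (\<lambda>u. \<Sum>(x, y) \<in># u. \<epsilon> x * \<delta> y)"
  define \<gamma> where "\<gamma> = (\<lambda>a. val (terms a))"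
  have E: "\<epsilon> \<zero>\<^bsub>M\<^esub> = 0" "\<And>x y. x \<in> carrier M \<Longrightarrow> y \<in> carrier M \<Longrightarrow> \<epsilon> (x \<oplus>\<^bsub>M\<^esub> y) = \<epsilon> x + \<epsilon> y"
    "\<And>r x. r \<in> carrier R \<Longrightarrow> x \<in> carrier M \<Longrightarrow> \<epsilon> (smult M r x) = r v * \<epsilon> x"
    "\<And>s x. s \<in> carrier S \<Longrightarrow> x \<in> carrier M \<Longrightarrow> \<epsilon> (rsmult M x s) = \<epsilon> x * s v"
    using \<epsilon> by (simp_all add: evaluation_def)
  have D: "\<delta> \<zero>\<^bsub>N\<^esub> = 0" "\<And>x y. x \<in> carrier N \<Longrightarrow> y \<in> carrier N \<Longrightarrow> \<delta> (x \<oplus>\<^bsub>N\<^esub> y) = \<delta> x + \<delta> y"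
    "\<And>r x. r \<in> carrier S \<Longrightarrow> x \<in> carrier N \<Longrightarrow> \<delta> (smult N r x) = r v * \<delta> x"
    "\<And>s x. s \<in> carrier T \<Longrightarrow> x \<in> carrier N \<Longrightarrow> \<delta> (rsmult N x s) = \<delta> x * s v"
    using \<delta> by (simp_all add: evaluation_def)
  have val_rel: "val u = val w" if "tensor_rel S M N u w" for u w
    using that by (induction rule: tensor_rel.induct) (simp_all add: val_def E D algebra_simps)
  have val: "\<gamma> (tensor_class S M N u) = val u" if "u \<in> formal_sums M N" for u
    unfolding \<gamma>_def by (intro val_rel terms_tensor_class that)
  have pure: "\<gamma> (pure_tensor S M N x y) = \<epsilon> x * \<delta> y" if "x \<in> carrier M" "y \<in> carrier N" for x y
    using that by (simp add: val formal_sums_single val_def)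
  have zero: "\<gamma> \<zero>\<^bsub>tensor S M N\<^esub> = 0"
    by (simp add: tensor_zero val formal_sums_empty) (simp add: val_def)
  have add: "\<gamma> (a \<oplus>\<^bsub>tensor S M N\<^esub> b) = \<gamma> a + \<gamma> b"
    if "a \<in> carrier (tensor S M N)" "b \<in> carrier (tensor S M N)" for a b
    using that by (auto simp: tensor_carrier class_add val formal_sums_add) (simp add: val_def)
  have smult: "\<gamma> (smult (tensor S M N) r a) = r v * \<gamma> a"
    if "r \<in> carrier R" "a \<in> carrier (tensor S M N)" for r a
    using that(2)
    by (induction rule: tensor_induct)
      (simp_all add: that(1) smult_zero zero smult_add add smult_closed smult_pure pure
        left.smult_closed E algebra_simps)
  have rsmult: "\<gamma> (rsmult (tensor S M N) a s) = \<gamma> a * s v"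
    if "s \<in> carrier T" "a \<in> carrier (tensor S M N)" for s a
    using that(2)
    by (induction rule: tensor_induct)
      (simp_all add: that(1) rsmult_zero zero rsmult_add add rsmult_closed rsmult_pure pure
        right.rsmult_closed D algebra_simps)
  show thesis
    by (rule that[of \<gamma>]) (simp_all add: evaluation_def zero add smult rsmult pure)
qed


section \<open>Bimodules of regular functions\<close>

abbreviation reg :: "'k::field_char_0 point set \<Rightarrow> ('k point \<Rightarrow> 'k) \<Rightarrow> ('k point \<Rightarrow> 'k) tens" where
  "reg X p \<equiv> Atom (restr X p)"

abbreviation Z_fun :: "nat \<Rightarrow> ('k::field_char_0 point \<Rightarrow> 'k) \<Rightarrow> 'k point \<Rightarrow> 'k" where
  "Z_fun n p \<equiv> restr (weyl_lines_union n) p"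

text \<open>
  Besides \<open>\<O>(Z)\<close>, the ring of \<open>s\<^sub>i\<close>-invariants acts on \<open>\<O>(V\<^sub>i)\<close>; this is what the two have in common.
\<close>

definition acts_by_restriction ::
  "('k::field_char_0 point \<Rightarrow> 'k) graded_ring \<Rightarrow> 'k point set \<Rightarrow> bool" where
  "acts_by_restriction R X \<longleftrightarrow> monoid.mult R = (\<lambda>f g v. f v * g v) \<and>
     \<one>\<^bsub>R\<^esub> \<in> carrier R \<and> (\<forall>v \<in> X. \<one>\<^bsub>R\<^esub> v = 1) \<and>
     (\<forall>f \<in> carrier R. \<forall>g \<in> carrier R. (\<lambda>v. f v * g v) \<in> carrier R) \<and>
     (\<forall>f \<in> carrier R. \<exists>p \<in> poly_fun. \<forall>v \<in> X. f v = p v)"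

lemma restr_mult: "(\<lambda>v. restr X p v * restr X q v) = restr X (\<lambda>v. p v * q v)"
  by (auto simp: restr_def fun_eq_iff)

lemma regular_ring_mult: "monoid.mult (regular_ring X) = (\<lambda>f g v. f v * g v)"
  and regular_ring_one: "\<one>\<^bsub>regular_ring X\<^esub> = restr X (\<lambda>_. 1)"
  and regular_ring_carrier: "carrier (regular_ring X) = restr X ` poly_fun"
  by (simp_all add: regular_ring_def)

lemma Rbar_mult: "f \<otimes>\<^bsub>Rbar n\<^esub> g = (\<lambda>v. f v * g v)"
  and Rbar_one: "\<one>\<^bsub>Rbar n\<^esub> = Z_fun n (\<lambda>_. 1)"
  and Rbar_carrier: "carrier (Rbar n) = restr (weyl_lines_union n) ` poly_fun"
  by (simp_all add: Rbar_def regular_ring_mult regular_ring_one regular_ring_carrier)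

lemma Z_fun_closed: "p \<in> poly_fun \<Longrightarrow> Z_fun n p \<in> carrier (Rbar n)"
  by (simp add: Rbar_carrier)

lemma acts_Rbar:
  assumes "X \<subseteq> weyl_lines_union n"
  shows "acts_by_restriction (Rbar n) X"
  unfolding acts_by_restriction_def
proof (intro conjI ballI)
  show "monoid.mult (Rbar n) = (\<lambda>f g v. f v * g v)" by (simp add: Rbar_def regular_ring_mult)
  show "\<one>\<^bsub>Rbar n\<^esub> \<in> carrier (Rbar n)"
    unfolding Rbar_one by (rule Z_fun_closed[OF poly_fun.const])
  show "\<one>\<^bsub>Rbar n\<^esub> v = 1" if "v \<in> X" for v
    using that assms by (auto simp: Rbar_one restr_def)
next
  fix f g :: "'a point \<Rightarrow> 'a" assume "f \<in> carrier (Rbar n)" "g \<in> carrier (Rbar n)"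
  then obtain p q where pq: "p \<in> poly_fun" "q \<in> poly_fun" "f = Z_fun n p" "g = Z_fun n q"
    by (auto simp: Rbar_carrier)
  then show "(\<lambda>v. f v * g v) \<in> carrier (Rbar n)"
    using Z_fun_closed[OF poly_fun.mult[OF pq(1,2)]] by (simp add: restr_mult)
next
  fix f :: "'a point \<Rightarrow> 'a" assume "f \<in> carrier (Rbar n)"
  then obtain p where "p \<in> poly_fun" "f = Z_fun n p" by (auto simp: Rbar_carrier)
  then show "\<exists>p \<in> poly_fun. \<forall>v \<in> X. f v = p v"
    using assms by (intro bexI[of _ p]) (auto simp: restr_def)
qed

lemma R_invariant_carrier:
  "f \<in> carrier (R_invariant n i) \<longleftrightarrow> f \<in> restr (V_simple n i) ` poly_fun \<and>
     (\<forall>v \<in> V_simple n i. f (act (simple_refl i) v) = f v)"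
  by (simp add: R_invariant_def R_simple_def regular_ring_carrier)

lemma R_invariant_mult: "f \<otimes>\<^bsub>R_invariant n i\<^esub> g = (\<lambda>v. f v * g v)"
  and R_invariant_one: "\<one>\<^bsub>R_invariant n i\<^esub> = restr (V_simple n i) (\<lambda>_. 1)"
  by (simp_all add: R_invariant_def R_simple_def regular_ring_def)

lemma restr_in_R_invariant:
  assumes i: "1 \<le> i" "i \<le> n" and p: "p \<in> poly_fun"
    and inv: "\<And>v. p (act (simple_refl i) v) = p v"
  shows "restr (V_simple n i) p \<in> carrier (R_invariant n i)"
  using p V_simple_act[OF i] by (auto simp: R_invariant_carrier restr_def inv)

lemma acts_R_invariant:
  assumes i: "1 \<le> i" "i \<le> n"
  shows "acts_by_restriction (R_invariant n i) (V_simple n i)"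
  unfolding acts_by_restriction_def
proof (intro conjI ballI)
  show "monoid.mult (R_invariant n i) = (\<lambda>f g v. f v * g v)"
    by (simp add: fun_eq_iff R_invariant_mult)
  show "\<one>\<^bsub>R_invariant n i\<^esub> \<in> carrier (R_invariant n i)"
    unfolding R_invariant_one by (rule restr_in_R_invariant[OF i poly_fun.const]) simp
  show "\<one>\<^bsub>R_invariant n i\<^esub> v = 1" if "v \<in> V_simple n i" for v
    using that by (auto simp: R_invariant_one restr_def)
next
  fix f g :: "'a point \<Rightarrow> 'a" assume fg: "f \<in> carrier (R_invariant n i)" "g \<in> carrier (R_invariant n i)"
  then obtain p q where pq: "p \<in> poly_fun" "q \<in> poly_fun" "f = restr (V_simple n i) p"
      "g = restr (V_simple n i) q"
    by (auto simp: R_invariant_carrier)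
  then have "(\<lambda>v. f v * g v) \<in> restr (V_simple n i) ` poly_fun"
    using poly_fun.mult[OF pq(1,2)] by (simp add: restr_mult)
  then show "(\<lambda>v. f v * g v) \<in> carrier (R_invariant n i)"
    using fg by (simp add: R_invariant_carrier)
next
  fix f :: "'a point \<Rightarrow> 'a" assume "f \<in> carrier (R_invariant n i)"
  then obtain p where "p \<in> poly_fun" "f = restr (V_simple n i) p" by (auto simp: R_invariant_carrier)
  then show "\<exists>p \<in> poly_fun. \<forall>v \<in> V_simple n i. f v = p v"
    by (intro bexI[of _ p]) (auto simp: restr_def)
qed

lemma reg_closed: "p \<in> poly_fun \<Longrightarrow> reg X p \<in> carrier (regular_bimod X)"
  by (simp add: regular_bimod_def regular_ring_carrier)

lemma reg_cases:
  assumes "a \<in> carrier (regular_bimod X)"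
  obtains p where "p \<in> poly_fun" "a = reg X p"
  using assms by (auto simp: regular_bimod_def regular_ring_carrier)

lemma reg_zero: "\<zero>\<^bsub>regular_bimod X\<^esub> = reg X (\<lambda>_. 0)"
  by (simp add: regular_bimod_def restr_def)

lemma reg_add: "reg X p \<oplus>\<^bsub>regular_bimod X\<^esub> reg X q = reg X (\<lambda>v. p v + q v)"
  by (auto simp: regular_bimod_def restr_def fun_eq_iff)

lemma reg_eqI: "(\<And>v. v \<in> X \<Longrightarrow> p v = q v) \<Longrightarrow> reg X p = reg X q"
  by (auto simp: restr_def fun_eq_iff)

lemma reg_smult_general:
  "(\<And>v. v \<in> X \<Longrightarrow> r v = p v) \<Longrightarrow> smult (regular_bimod X) r (reg X q) = reg X (\<lambda>v. p v * q v)"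
  "(\<And>v. v \<in> X \<Longrightarrow> r v = p v) \<Longrightarrow> rsmult (regular_bimod X) (reg X q) r = reg X (\<lambda>v. q v * p v)"
  by (auto simp: regular_bimod_def restr_def fun_eq_iff)

lemma reg_smult:
  "X \<subseteq> weyl_lines_union n \<Longrightarrow> smult (regular_bimod X) (Z_fun n p) (reg X q) = reg X (\<lambda>v. p v * q v)"
  "X \<subseteq> weyl_lines_union n \<Longrightarrow> rsmult (regular_bimod X) (reg X q) (Z_fun n p) = reg X (\<lambda>v. q v * p v)"
  by (rule reg_smult_general; auto simp: restr_def)+

lemma bimodule_regular:
  assumes "acts_by_restriction R X" "acts_by_restriction S X"
  shows "bimodule R S (regular_bimod X)"
proof -
  let ?M = "regular_bimod X"
  have R: "\<exists>p \<in> poly_fun. \<forall>v \<in> X. f v = p v" if "f \<in> carrier R" for f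
    using assms(1) that by (auto simp: acts_by_restriction_def)
  have S: "\<exists>p \<in> poly_fun. \<forall>v \<in> X. f v = p v" if "f \<in> carrier S" for f
    using assms(2) that by (auto simp: acts_by_restriction_def)
  show ?thesis
  proof
    show "\<one>\<^bsub>R\<^esub> \<in> carrier R" "\<one>\<^bsub>S\<^esub> \<in> carrier S"
      using assms by (simp_all add: acts_by_restriction_def)
    show "\<And>r r'. r \<in> carrier R \<Longrightarrow> r' \<in> carrier R \<Longrightarrow> r \<otimes>\<^bsub>R\<^esub> r' \<in> carrier R"
      "\<And>s s'. s \<in> carrier S \<Longrightarrow> s' \<in> carrier S \<Longrightarrow> s \<otimes>\<^bsub>S\<^esub> s' \<in> carrier S"
      using assms by (simp_all add: acts_by_restriction_def)
    show "\<zero>\<^bsub>?M\<^esub> \<in> carrier ?M" by (simp add: reg_zero reg_closed poly_fun.const)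
  next
    fix x y assume "x \<in> carrier ?M" "y \<in> carrier ?M"
    then show "x \<oplus>\<^bsub>?M\<^esub> y \<in> carrier ?M"
      by (elim reg_cases) (simp add: reg_add reg_closed poly_fun.add)
  next
    fix r x assume r: "r \<in> carrier R" and x: "x \<in> carrier ?M"
    obtain p q where "p \<in> poly_fun" "\<And>v. v \<in> X \<Longrightarrow> r v = p v" "q \<in> poly_fun" "x = reg X q"
      using R[OF r] x by (metis reg_cases)
    then show "smult ?M r x \<in> carrier ?M"
      by (simp add: reg_smult_general reg_closed poly_fun.mult)
  next
    fix r x assume r: "r \<in> carrier S" and x: "x \<in> carrier ?M"
    obtain p q where "p \<in> poly_fun" "\<And>v. v \<in> X \<Longrightarrow> r v = p v" "q \<in> poly_fun" "x = reg X q"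
      using S[OF r] x by (metis reg_cases)
    then show "rsmult ?M x r \<in> carrier ?M"
      by (simp add: reg_smult_general reg_closed poly_fun.mult)
  qed (use assms in \<open>auto simp: acts_by_restriction_def regular_bimod_def regular_ring_carrier restr_def
        fun_eq_iff algebra_simps\<close>)
qed

lemma evaluation_regular:
  "evaluation R S (regular_bimod X) v (\<lambda>a. case a of Atom f \<Rightarrow> f v | Formal _ \<Rightarrow> 0)"
  by (auto simp: evaluation_def regular_bimod_def)

text \<open>
  The properties of the generator \<open>e\<close> that survive multiplication by a further \<open>B\<^sub>j\<close>. The last one
  excludes \<open>e = 0\<close>, and it shows that the alternating point belongs to the supports.
\<close>

definition cyclic_bimodule ::
  "nat \<Rightarrow> ('k::field_char_0 point \<Rightarrow> 'k, 'b) gbimod \<Rightarrow> 'b \<Rightarrow> bool" where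
  "cyclic_bimodule n M e \<longleftrightarrow>
     bimodule (Rbar n) (Rbar n) M \<and> e \<in> carrier M \<and> e \<in> grade M 0 \<and>
     carrier M \<subseteq> generated (Rbar n) (Rbar n) M e \<and>
     (\<forall>c. smult M (Z_fun n (\<lambda>_. c)) e = rsmult M e (Z_fun n (\<lambda>_. c))) \<and>
     (\<exists>\<epsilon>. evaluation (Rbar n) (Rbar n) M (alternating_point n) \<epsilon> \<and> \<epsilon> e = 1)"

text \<open>
  Here \<open>i\<close> is the last letter of the word and \<open>\<pi>\<close> its diagram. A coordinate function acting on the
  generator from the right is carried along the strand that starts there. If the strand ends on the
  left boundary, the coordinate becomes one acting from the left. If it returns, the coordinate is
  replaced by the other of the two values of the coordinates; on the support, which lies in \<open>V\<^sub>i\<close>,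
  the sum of these two values is \<open>x\<^sub>i + x\<^sub>i\<^sub>+\<^sub>1\<close>.
\<close>

definition strands ::
  "nat \<Rightarrow> nat \<Rightarrow> ('k::field_char_0 point \<Rightarrow> 'k, 'b) gbimod \<Rightarrow> 'b \<Rightarrow> (nat \<Rightarrow> strand_end) \<Rightarrow> bool" where
  "strands n i M e \<pi> \<longleftrightarrow>
     (\<forall>r \<in> carrier (Rbar n). (\<forall>v \<in> V_simple n i. r v = 0) \<longrightarrow>
        (\<forall>x \<in> carrier M. rsmult M x r = \<zero>\<^bsub>M\<^esub>)) \<and>
     (\<forall>m p. \<pi> m = Left p \<longrightarrow> rsmult M e (Z_fun n (\<lambda>v. v m)) = smult M (Z_fun n (\<lambda>v. v p)) e) \<and>
     (\<forall>m m'. \<pi> m = Right m' \<longrightarrow>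
        rsmult M e (Z_fun n (\<lambda>v. v m)) = rsmult M e (Z_fun n (\<lambda>v. v i + v (Suc i) - v m')))"

lemma reg_one_grade: "reg X (\<lambda>_. 1) \<in> grade (regular_bimod X) 0"
  by (simp add: regular_bimod_def regular_ring_def homog_poly_fun.const)

section \<open>The bimodule of a simple reflection\<close>

locale simple_letter =
  fixes n j :: nat and k_type :: "'k::field_char_0 itself"
  assumes j: "1 \<le> j" "j \<le> n"
begin

abbreviation V :: "'k point set" where "V \<equiv> V_simple n j"
abbreviation Bj :: "('k point \<Rightarrow> 'k, ('k point \<Rightarrow> 'k) tens) gbimod" where "Bj \<equiv> B_simple n j"
abbreviation bj :: "('k point \<Rightarrow> 'k) tens" where
  "bj \<equiv> pure_tensor (R_invariant n j) (regular_bimod V) (regular_bimod V) (reg V (\<lambda>_. 1)) (reg V (\<lambda>_. 1))"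

lemma pair: "tensor_pair (Rbar n) (R_invariant n j) (Rbar n) (regular_bimod V) (regular_bimod V)"
  by (intro tensor_pair.intro bimodule_regular acts_Rbar acts_R_invariant[OF j] V_simple_subset)

sublocale simple: tensor_pair "Rbar n" "R_invariant n j" "Rbar n" "regular_bimod V" "regular_bimod V"
  rewrites "tensor (R_invariant n j) (regular_bimod V) (regular_bimod V) \<equiv> Bj"
  by (rule pair) (simp add: B_simple_def)

lemma one_closed: "reg V (\<lambda>_. 1) \<in> carrier (regular_bimod V)"
  by (intro reg_closed poly_fun.const)

lemma bj_closed: "bj \<in> carrier Bj"
  by (intro simple.pure_closed one_closed)

lemma bj_outer:
  assumes p: "p \<in> poly_fun"
  shows "smult Bj (Z_fun n p) bj = pure_tensor (R_invariant n j) (regular_bimod V) (regular_bimod V) (reg V p) (reg V (\<lambda>_. 1))"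
    and "rsmult Bj bj (Z_fun n p) = pure_tensor (R_invariant n j) (regular_bimod V) (regular_bimod V) (reg V (\<lambda>_. 1)) (reg V p)"
  using p by (simp_all add: simple.smult_pure simple.rsmult_pure Z_fun_closed one_closed reg_smult V_simple_subset)

text \<open>
  Invariants of \<open>s\<^sub>j\<close> can be moved across the inner tensor sign of \<open>B\<^sub>j\<close>.
\<close>

lemma bj_cross:
  assumes p: "p \<in> poly_fun" and inv: "\<And>v. p (act (simple_refl j) v) = p v"
  shows "smult Bj (Z_fun n p) bj = rsmult Bj bj (Z_fun n p)"
proof -
  have inv: "restr V p \<in> carrier (R_invariant n j)" by (rule restr_in_R_invariant[OF j p inv])
  have "reg V p = rsmult (regular_bimod V) (reg V (\<lambda>_. 1)) (restr V p)"
    "reg V p = smult (regular_bimod V) (restr V p) (reg V (\<lambda>_. 1))"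
    by (subst reg_smult_general[where p = p]; simp add: restr_def)+
  then show ?thesis
    unfolding bj_outer[OF p] using simple.pure_balanced[OF one_closed inv one_closed] by simp
qed

lemma Bj_generated: "carrier Bj \<subseteq> generated (Rbar n) (Rbar n) Bj bj"
proof
  fix b assume "b \<in> carrier Bj"
  then show "b \<in> generated (Rbar n) (Rbar n) Bj bj"
  proof (induction rule: simple.tensor_induct)
    case (pure x y)
    then obtain p q where pq: "p \<in> poly_fun" "x = reg V p" "q \<in> poly_fun" "y = reg V q"
      by (metis reg_cases)
    have "smult Bj (Z_fun n p) (rsmult Bj bj (Z_fun n q)) = 
      pure_tensor (R_invariant n j) (regular_bimod V) (regular_bimod V) x y"
      unfolding bj_outer[OF pq(3)] using pq
      by (simp add: simple.smult_pure Z_fun_closed reg_closed one_closed reg_smult V_simple_subset)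
    then show ?case using generated.gen Z_fun_closed pq by metis
  qed (auto intro: generated.intros)
qed

lemma Bj_right_annihilated:
  assumes "r \<in> carrier (Rbar n)" "\<And>v. v \<in> V \<Longrightarrow> r v = 0" "b \<in> carrier Bj"
  shows "rsmult Bj b r = \<zero>\<^bsub>Bj\<^esub>"
proof (rule simple.rsmult_eq_zero[OF assms(1) _ assms(3)])
  fix y assume "y \<in> carrier (regular_bimod V)"
  then obtain q where "y = reg V q" by (rule reg_cases)
  then show "rsmult (regular_bimod V) y r = \<zero>\<^bsub>regular_bimod V\<^esub>"
    using reg_smult_general(2)[of V r "\<lambda>_. 0" q] assms(2) by (simp add: reg_zero)
qed

lemma Bj_left_annihilated:
  assumes "r \<in> carrier (Rbar n)" "\<And>v. v \<in> V \<Longrightarrow> r v = 0" "b \<in> carrier Bj"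
  shows "smult Bj r b = \<zero>\<^bsub>Bj\<^esub>"
proof (rule simple.smult_eq_zero[OF assms(1) _ assms(3)])
  fix y assume "y \<in> carrier (regular_bimod V)"
  then obtain q where "y = reg V q" by (rule reg_cases)
  then show "smult (regular_bimod V) r y = \<zero>\<^bsub>regular_bimod V\<^esub>"
    using reg_smult_general(1)[of V r "\<lambda>_. 0" q] assms(2) by (simp add: reg_zero)
qed

lemma Bj_evaluation:
  obtains \<epsilon> where "evaluation (Rbar n) (Rbar n) Bj (alternating_point n) \<epsilon>" "\<epsilon> bj = 1"
proof -
  have 1: "(case reg V (\<lambda>_. 1) of Atom f \<Rightarrow> f (alternating_point n) | Formal _ \<Rightarrow> 0) = 1"
    using alternating_point_in_V_simple[OF j] by (simp add: restr_def)
  obtain \<gamma> where \<gamma>: "evaluation (Rbar n) (Rbar n) Bj (alternating_point n) \<gamma>"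
    "\<And>x y. x \<in> carrier (regular_bimod V) \<Longrightarrow> y \<in> carrier (regular_bimod V) \<Longrightarrow>
      \<gamma> (pure_tensor (R_invariant n j) (regular_bimod V) (regular_bimod V) x y) =
      (case x of Atom f \<Rightarrow> f (alternating_point n) | Formal _ \<Rightarrow> 0) *
      (case y of Atom f \<Rightarrow> f (alternating_point n) | Formal _ \<Rightarrow> 0)"
    using evaluation_tensor[OF pair evaluation_regular evaluation_regular] unfolding B_simple_def by blast
  show thesis
    by (rule that[OF \<gamma>(1)]) (simp only: \<gamma>(2)[OF one_closed one_closed] 1 mult_1)
qed

lemma bj_grade: "bj \<in> grade Bj 0"
  using simple.pure_grade[OF reg_one_grade reg_one_grade] by simp

lemma Bj_cyclic: "cyclic_bimodule n Bj bj"
  unfolding cyclic_bimodule_def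
  using simple.bimodule_axioms bj_closed bj_grade Bj_generated Bj_evaluation
    bj_cross[OF poly_fun.const] by blast

lemma Bj_strands: "strands n j Bj bj (attach_letter j Left)"
  unfolding strands_def
proof (intro conjI ballI allI impI)
  fix r x assume "r \<in> carrier (Rbar n)" "\<forall>v\<in>V. r v = 0" "x \<in> carrier Bj"
  then show "rsmult Bj x r = \<zero>\<^bsub>Bj\<^esub>" by (simp add: Bj_right_annihilated)
next
  fix m p assume "attach_letter j Left m = Left p"
  then have "m = p" "m \<noteq> j" "m \<noteq> Suc j" by (auto simp: attach_letter_def split: if_splits)
  then show "rsmult Bj bj (Z_fun n (\<lambda>v. v m)) = smult Bj (Z_fun n (\<lambda>v. v p)) bj"
    using bj_cross[OF poly_fun.coord[of m]] by (simp add: act_simple_refl)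
next
  fix m m' assume "attach_letter j Left m = Right m'"
  then have "m = j \<and> m' = Suc j \<or> m = Suc j \<and> m' = j" by (auto simp: attach_letter_def split: if_splits)
  then show "rsmult Bj bj (Z_fun n (\<lambda>v. v m)) = rsmult Bj bj (Z_fun n (\<lambda>v. v j + v (Suc j) - v m'))"
    by auto
qed

end


section \<open>Multiplying by one more letter\<close>

text \<open>
  Given \<open>M\<close> with generator \<open>e\<close>, the product with \<open>B\<^sub>j\<close> is spanned over both sides by the elements
  \<open>mid f = (e \<otimes> f) \<otimes> (1 \<otimes> 1)\<close> with \<open>f\<close> a function on the common support \<open>X\<close>, and it remains to move \<open>f\<close>
  to one of the two sides. Coordinates other than \<open>x\<^sub>j\<close> and \<open>x\<^sub>j\<^sub>+\<^sub>1\<close> are invariant under \<open>s\<^sub>j\<close> and cross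
  \<open>B\<^sub>j\<close>. The coordinates \<open>x\<^sub>j\<close> and \<open>x\<^sub>j\<^sub>+\<^sub>1\<close> follow their strands back through \<open>M\<close>. Since no loop is closed,
  these strands leave \<open>M\<close> on the left, or return to a position different from \<open>j\<close> and \<open>j + 1\<close>, whose
  coordinate crosses \<open>B\<^sub>j\<close>.
\<close>

locale strand_step = simple_letter n j k_type
  for n j :: nat and k_type :: "'k::field_char_0 itself" +
  fixes i :: nat and M :: "('k point \<Rightarrow> 'k, ('k point \<Rightarrow> 'k) tens) gbimod"
    and e :: "('k point \<Rightarrow> 'k) tens" and \<pi> :: "nat \<Rightarrow> strand_end"
  assumes i: "1 \<le> i" "i \<le> n"
    and cyclic: "cyclic_bimodule n M e"
    and strands: "strands n i M e \<pi>"
    and open_left: "\<And>q. \<pi> j = Right q \<Longrightarrow> q < j"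
    and open_right: "\<And>q. \<pi> (Suc j) = Right q \<Longrightarrow> Suc j < q"
begin

abbreviation R :: "('k point \<Rightarrow> 'k) graded_ring" where "R \<equiv> Rbar n"

sublocale M: bimodule R R M
  using cyclic by (simp add: cyclic_bimodule_def)

lemma e_closed: "e \<in> carrier M"
  using cyclic by (simp add: cyclic_bimodule_def)

lemma right_annihilated:
  "\<lbrakk>r \<in> carrier R; \<And>v. v \<in> V_simple n i \<Longrightarrow> r v = 0; x \<in> carrier M\<rbrakk> \<Longrightarrow> rsmult M x r = \<zero>\<^bsub>M\<^esub>"
  using strands by (simp add: strands_def)

lemma strand_through: "\<pi> m = Left p \<Longrightarrow> rsmult M e (Z_fun n (\<lambda>v. v m)) = smult M (Z_fun n (\<lambda>v. v p)) e"
  using strands unfolding strands_def by blast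

lemma strand_back:
  "\<pi> m = Right m' \<Longrightarrow> rsmult M e (Z_fun n (\<lambda>v. v m)) = rsmult M e (Z_fun n (\<lambda>v. v i + v (Suc i) - v m'))"
  using strands unfolding strands_def by blast

definition X :: "'k point set" where
  "X = right_support n M \<inter> left_support n Bj"

lemma X_subset: "X \<subseteq> weyl_lines_union n"
  by (auto simp: X_def left_support_def)

lemma X_subset_left: "X \<subseteq> V_simple n i"
proof
  fix x assume "x \<in> X"
  then have "x \<in> weyl_lines_union n" "\<And>r. r \<in> right_annihilator R M \<Longrightarrow> r x = 0"
    by (simp_all add: X_def right_support_def)
  then show "x \<in> V_simple n i"
    using right_annihilated by (intro V_simple_zero_locus[OF i]) (auto simp: right_annihilator_def)
qed

lemma X_subset_right: "X \<subseteq> V"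
proof
  fix x assume "x \<in> X"
  then have "x \<in> weyl_lines_union n" "\<And>r. r \<in> left_annihilator R Bj \<Longrightarrow> r x = 0"
    by (simp_all add: X_def left_support_def)
  then show "x \<in> V"
    using Bj_left_annihilated by (intro V_simple_zero_locus[OF j]) (auto simp: left_annihilator_def)
qed

lemma alternating_point_in_X: "alternating_point n \<in> X"
proof -
  let ?a = "alternating_point n :: 'k point"
  obtain \<epsilon> where \<epsilon>: "evaluation R R M ?a \<epsilon>" "\<epsilon> e = 1"
    using cyclic by (auto simp: cyclic_bimodule_def)
  obtain \<delta> where \<delta>: "evaluation R R Bj ?a \<delta>" "\<delta> bj = 1"
    by (rule Bj_evaluation)
  have "r ?a = 0" if r: "r \<in> right_annihilator R M" for r
  proof -
    have "rsmult M e r = \<zero>\<^bsub>M\<^esub>" "r \<in> carrier R" using r e_closed by (auto simp: right_annihilator_def)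
    then show ?thesis using \<epsilon> e_closed unfolding evaluation_def by (metis mult_1)
  qed
  moreover have "r ?a = 0" if r: "r \<in> left_annihilator R Bj" for r
  proof -
    have "smult Bj r bj = \<zero>\<^bsub>Bj\<^esub>" "r \<in> carrier R" using r bj_closed by (auto simp: left_annihilator_def)
    then show ?thesis using \<delta> bj_closed unfolding evaluation_def by (metis mult_1_right)
  qed
  moreover have "?a \<in> weyl_lines_union n"
    using alternating_point_in_V_simple[OF j] V_simple_subset by blast
  ultimately show ?thesis by (simp add: X_def left_support_def right_support_def)
qed

abbreviation "N \<equiv> tensor R M (regular_bimod X)"
abbreviation "P \<equiv> star n M Bj"

sublocale N: tensor_pair R R R M "regular_bimod X"
  by (intro tensor_pair.intro bimodule_regular acts_Rbar X_subset M.bimodule_axioms)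

sublocale P: tensor_pair R R R N Bj
  rewrites "tensor R N Bj \<equiv> P"
  by (intro tensor_pair.intro N.bimodule_axioms simple.bimodule_axioms) (simp add: star_def X_def)

abbreviation left_part :: "('k point \<Rightarrow> 'k) \<Rightarrow> ('k point \<Rightarrow> 'k) tens" where
  "left_part p \<equiv> pure_tensor R M (regular_bimod X) e (reg X p)"

definition mid :: "('k point \<Rightarrow> 'k) \<Rightarrow> ('k point \<Rightarrow> 'k) tens" where
  "mid p = pure_tensor R N Bj (left_part p) bj"

definition e' :: "('k point \<Rightarrow> 'k) tens" where
  "e' = mid (\<lambda>_. 1)"

lemma left_part_closed: "p \<in> poly_fun \<Longrightarrow> left_part p \<in> carrier N"
  by (intro N.pure_closed e_closed reg_closed)

lemma mid_closed: "p \<in> poly_fun \<Longrightarrow> mid p \<in> carrier P"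
  unfolding mid_def by (intro P.pure_closed left_part_closed bj_closed)

lemma e'_closed: "e' \<in> carrier P"
  unfolding e'_def by (intro mid_closed poly_fun.const)

lemma mid_cong: "(\<And>v. v \<in> X \<Longrightarrow> p v = q v) \<Longrightarrow> mid p = mid q"
  unfolding mid_def by (simp add: reg_eqI[of X p q])

text \<open>
  On \<open>X\<close> the sum of the two values of the coordinates can be read off at either letter. This makes the sum
  used in a returning strand invariant under \<open>s\<^sub>j\<close>.
\<close>

lemma mid_sum_at_letters: "mid (\<lambda>v. (v i + v (Suc i) - r v) * q v) = mid (\<lambda>v. (v j + v (Suc j) - r v) * q v)"
  using two_values_sum_eq[OF i j] X_subset_left X_subset_right by (intro mid_cong) auto

lemma left_part_mult:
  assumes "p \<in> poly_fun" "q \<in> poly_fun"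
  shows "left_part (\<lambda>v. p v * q v) = pure_tensor R M (regular_bimod X) (rsmult M e (Z_fun n p)) (reg X q)"
    and "left_part (\<lambda>v. p v * q v) = rsmult N (left_part q) (Z_fun n p)"
proof -
  show "left_part (\<lambda>v. p v * q v) = pure_tensor R M (regular_bimod X) (rsmult M e (Z_fun n p)) (reg X q)"
    using N.pure_balanced[OF e_closed Z_fun_closed[OF assms(1)] reg_closed[OF assms(2)]]
    by (simp add: reg_smult[OF X_subset])
  show "left_part (\<lambda>v. p v * q v) = rsmult N (left_part q) (Z_fun n p)"
    using N.rsmult_pure[OF Z_fun_closed[OF assms(1)] e_closed reg_closed[OF assms(2)]]
    by (simp add: reg_smult[OF X_subset] mult.commute)
qed

lemma mid_cross:
  assumes p: "p \<in> poly_fun" and q: "q \<in> poly_fun" and inv: "\<And>v. p (act (simple_refl j) v) = p v"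
  shows "mid (\<lambda>v. p v * q v) = rsmult P (mid q) (Z_fun n p)"
proof -
  have "mid (\<lambda>v. p v * q v) = pure_tensor R N Bj (left_part q) (smult Bj (Z_fun n p) bj)"
    unfolding mid_def left_part_mult(2)[OF p q]
    by (intro P.pure_balanced left_part_closed q Z_fun_closed p bj_closed)
  then show ?thesis
    unfolding bj_cross[OF p inv] mid_def
    by (simp add: P.rsmult_pure[OF Z_fun_closed[OF p] left_part_closed[OF q] bj_closed])
qed

lemma mid_out_left:
  assumes p: "p \<in> poly_fun" and q: "q \<in> poly_fun" and r: "r \<in> poly_fun"
    and eq: "rsmult M e (Z_fun n p) = smult M (Z_fun n r) e"
  shows "mid (\<lambda>v. p v * q v) = smult P (Z_fun n r) (mid q)"
  unfolding mid_def left_part_mult(1)[OF p q] eq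
  by (simp add: P.smult_pure N.smult_pure Z_fun_closed r q e_closed reg_closed left_part_closed bj_closed)

lemma mid_exchange:
  assumes p: "p \<in> poly_fun" and q: "q \<in> poly_fun" and r: "r \<in> poly_fun"
    and eq: "rsmult M e (Z_fun n p) = rsmult M e (Z_fun n r)"
  shows "mid (\<lambda>v. p v * q v) = mid (\<lambda>v. r v * q v)"
  unfolding mid_def left_part_mult(1)[OF p q] left_part_mult(1)[OF r q] eq ..

lemma poly_reflected: "(\<lambda>v :: 'k point. v a + v b - v c) \<in> poly_fun"
  by (rule poly_fun_diff[OF poly_fun.add[OF poly_fun.coord poly_fun.coord] poly_fun.coord])

lemma mid_strand_back:
  assumes "\<pi> m = Right m'" "q \<in> poly_fun"
  shows "mid (\<lambda>v. v m * q v) = mid (\<lambda>v. (v j + v (Suc j) - v m') * q v)"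
  using mid_exchange[OF poly_fun.coord assms(2) poly_reflected strand_back[OF assms(1)]]
  by (simp add: mid_sum_at_letters)

lemma mid_strand_through:
  assumes "\<pi> m = Left p" "q \<in> poly_fun"
  shows "mid (\<lambda>v. v m * q v) = smult P (Z_fun n (\<lambda>v. v p)) (mid q)"
  by (rule mid_out_left[OF poly_fun.coord assms(2) poly_fun.coord strand_through[OF assms(1)]])

lemma mid_coord_cross:
  assumes "m \<noteq> j" "m \<noteq> Suc j" "q \<in> poly_fun"
  shows "mid (\<lambda>v. v m * q v) = rsmult P (mid q) (Z_fun n (\<lambda>v. v m))"
  using assms by (intro mid_cross poly_fun.coord) (auto simp: act_simple_refl)

lemma mid_reflected_cross:
  assumes "m \<noteq> j" "m \<noteq> Suc j" "q \<in> poly_fun"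
  shows "mid (\<lambda>v. (v j + v (Suc j) - v m) * q v) =
    rsmult P (mid q) (Z_fun n (\<lambda>v. v j + v (Suc j) - v m))"
  using assms by (intro mid_cross poly_reflected) (auto simp: act_simple_refl)

text \<open>
  The factor \<open>q\<close> is carried along so that the coordinates of a monomial can be removed one by one.
\<close>

lemma mid_coord_generated:
  assumes q: "q \<in> poly_fun" and gen: "mid q \<in> generated R R P e'"
  shows "mid (\<lambda>v. v m * q v) \<in> generated R R P e'"
proof -
  have left: ?thesis if "\<pi> m = Left p" for p
    unfolding mid_strand_through[OF that q]
    by (intro P.generated_smult e'_closed Z_fun_closed poly_fun.coord gen)
  have right: ?thesis if "\<pi> m = Right p" "p \<noteq> j" "p \<noteq> Suc j" for p
    unfolding mid_strand_back[OF that(1) q] mid_reflected_cross[OF that(2,3) q]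
    by (intro P.generated_rsmult e'_closed Z_fun_closed poly_reflected gen)
  consider "m = j" | "m = Suc j" | "m \<noteq> j" "m \<noteq> Suc j" by blast
  then show ?thesis
  proof cases
    case 1
    then show ?thesis using open_left left right by (cases "\<pi> m") force+
  next
    case 2
    then show ?thesis using open_right left right by (cases "\<pi> m") force+
  next
    case 3
    show ?thesis unfolding mid_coord_cross[OF 3 q]
      by (intro P.generated_rsmult e'_closed Z_fun_closed poly_fun.coord gen)
  qed
qed

lemma mid_add:
  assumes "p \<in> poly_fun" "q \<in> poly_fun"
  shows "mid (\<lambda>v. p v + q v) = mid p \<oplus>\<^bsub>P\<^esub> mid q"
  unfolding mid_def reg_add[symmetric]
  by (simp add: N.pure_add_right P.pure_add_left assms e_closed reg_closed left_part_closed bj_closed)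

lemma mid_generated:
  assumes p: "p \<in> poly_fun"
  shows "mid p \<in> generated R R P e'"
proof -
  have "\<forall>q \<in> poly_fun. mid q \<in> generated R R P e' \<longrightarrow> mid (\<lambda>v. p v * q v) \<in> generated R R P e'"
    using p
  proof (induction rule: poly_fun.induct)
    case (const c)
    then show ?case
      by (auto simp: mid_cross[OF poly_fun.const]
          intro!: P.generated_rsmult e'_closed Z_fun_closed poly_fun.const)
  next
    case (coord m)
    then show ?case using mid_coord_generated by blast
  next
    case (add p r)
    then show ?case
      by (simp add: distrib_right mid_add poly_fun.mult generated.add)
  next
    case (mult p r)
    then show ?case by (simp add: mult.assoc poly_fun.mult)
  qed
  then have "mid (\<lambda>v. p v * 1) \<in> generated R R P e'"
    using P.generated_generator[OF e'_closed] poly_fun.const[of 1] unfolding e'_def by blast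
  then show ?thesis by simp
qed

lemma P_generated: "carrier P \<subseteq> generated R R P e'"
proof
  fix a assume "a \<in> carrier P"
  have gen1: "pure_tensor R N Bj (pure_tensor R M (regular_bimod X) m (reg X f)) bj \<in> generated R R P e'"
    if m: "m \<in> generated R R M e" and f: "f \<in> poly_fun" for m f
    using m
  proof (induction rule: generated.induct)
    case zero
    then show ?case
      by (simp add: N.pure_zero_left P.pure_zero_left reg_closed f bj_closed generated.zero)
  next
    case (gen r s)
    then obtain q where q: "q \<in> poly_fun" "s = Z_fun n q" by (auto simp: Rbar_carrier)
    have "pure_tensor R M (regular_bimod X) (smult M r (rsmult M e s)) (reg X f) =
      smult N r (left_part (\<lambda>v. q v * f v))"
      using gen q(1) unfolding left_part_mult(1)[OF q(1) f]
      by (simp add: N.smult_pure M.rsmult_closed e_closed reg_closed f q(2))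
    then have "pure_tensor R N Bj (pure_tensor R M (regular_bimod X) (smult M r (rsmult M e s)) (reg X f)) bj =
      smult P r (mid (\<lambda>v. q v * f v))"
      using gen(1) q f by (simp add: mid_def P.smult_pure left_part_closed poly_fun.mult bj_closed)
    then show ?case
      using P.generated_smult[OF e'_closed gen(1) mid_generated[OF poly_fun.mult[OF q(1) f]]] by simp
  next
    case (add x y)
    then have "x \<in> carrier M" "y \<in> carrier M" using M.generated_closed[OF e_closed] by auto
    then show ?case
      using add by (simp add: N.pure_add_left P.pure_add_left N.pure_closed reg_closed f bj_closed generated.add)
  qed
  have gen2: "pure_tensor R N Bj t bj \<in> generated R R P e'" if "t \<in> carrier N" for t
    using that
  proof (induction rule: N.tensor_induct)
    case zero
    then show ?case by (simp add: P.pure_zero_left bj_closed generated.zero)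
  next
    case (pure x y)
    obtain f where "f \<in> poly_fun" "y = reg X f" using pure(2) by (rule reg_cases)
    moreover have "x \<in> generated R R M e"
      using cyclic pure(1) by (auto simp: cyclic_bimodule_def)
    ultimately show ?case using gen1 by simp
  next
    case (add a b)
    then show ?case by (simp add: P.pure_add_left bj_closed generated.add)
  qed
  have gen3: "pure_tensor R N Bj t b \<in> generated R R P e'"
    if t: "t \<in> carrier N" and b: "b \<in> generated R R Bj bj" for t b
    using b
  proof (induction rule: generated.induct)
    case zero
    then show ?case using t by (simp add: P.pure_zero_right generated.zero)
  next
    case (gen r s)
    have "pure_tensor R N Bj t (smult Bj r (rsmult Bj bj s)) =
        rsmult P (pure_tensor R N Bj (rsmult N t r) bj) s"
      using gen t
      by (simp add: P.pure_balanced[symmetric] P.rsmult_pure simple.rsmult_closed bj_closed N.rsmult_closed)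
    then show ?case
      using P.generated_rsmult[OF e'_closed gen(2) gen2[OF N.rsmult_closed[OF gen(1) t]]] by simp
  next
    case (add x y)
    then show ?case
      using t simple.generated_closed[OF bj_closed] by (simp add: P.pure_add_right generated.add)
  qed
  show "a \<in> generated R R P e'"
    using \<open>a \<in> carrier P\<close>
  proof (induction rule: P.tensor_induct)
    case (pure x y)
    then show ?case using gen3 Bj_generated by blast
  qed (auto intro: generated.intros)
qed

lemma e'_evaluation:
  obtains \<epsilon> where "evaluation R R P (alternating_point n) \<epsilon>" "\<epsilon> e' = 1"
proof -
  obtain \<epsilon> where \<epsilon>: "evaluation R R M (alternating_point n) \<epsilon>" "\<epsilon> e = 1"
    using cyclic by (auto simp: cyclic_bimodule_def)
  obtain \<delta> where \<delta>: "evaluation R R Bj (alternating_point n) \<delta>" "\<delta> bj = 1"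
    by (rule Bj_evaluation)
  obtain \<gamma> where \<gamma>: "evaluation R R N (alternating_point n) \<gamma>"
    "\<And>x y. x \<in> carrier M \<Longrightarrow> y \<in> carrier (regular_bimod X) \<Longrightarrow>
      \<gamma> (pure_tensor R M (regular_bimod X) x y) =
      \<epsilon> x * (case y of Atom f \<Rightarrow> f (alternating_point n) | Formal _ \<Rightarrow> 0)"
    using evaluation_tensor[OF N.tensor_pair_axioms \<epsilon>(1) evaluation_regular] by blast
  obtain \<eta> where \<eta>: "evaluation R R P (alternating_point n) \<eta>"
    "\<And>x y. x \<in> carrier N \<Longrightarrow> y \<in> carrier Bj \<Longrightarrow> \<eta> (pure_tensor R N Bj x y) = \<gamma> x * \<delta> y"
    using evaluation_tensor[OF P.tensor_pair_axioms \<gamma>(1) \<delta>(1)] unfolding star_def X_def by blast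
  have "\<gamma> (left_part (\<lambda>_. 1)) = 1"
    using alternating_point_in_X \<epsilon>(2) \<gamma>(2)[OF e_closed reg_closed[OF poly_fun.const]]
    by (simp add: restr_def)
  then have "\<eta> e' = 1"
    by (simp add: e'_def mid_def \<eta>(2) left_part_closed poly_fun.const bj_closed \<delta>(2))
  then show thesis using that \<eta>(1) by blast
qed

lemma e'_grade: "e' \<in> grade P 0"
proof -
  have "e \<in> grade M 0" using cyclic by (simp add: cyclic_bimodule_def)
  from P.pure_grade[OF N.pure_grade[OF this reg_one_grade] bj_grade]
  show ?thesis by (simp add: e'_def mid_def)
qed

lemma e'_const: "smult P (Z_fun n (\<lambda>_. c)) e' = rsmult P e' (Z_fun n (\<lambda>_. c))"
proof -
  have "rsmult M e (Z_fun n (\<lambda>_. c)) = smult M (Z_fun n (\<lambda>_. c)) e"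
    using cyclic by (simp add: cyclic_bimodule_def)
  then have "mid (\<lambda>v. c * 1) = smult P (Z_fun n (\<lambda>_. c)) e'"
    unfolding e'_def by (intro mid_out_left poly_fun.const)
  moreover have "mid (\<lambda>v. c * 1) = rsmult P e' (Z_fun n (\<lambda>_. c))"
    unfolding e'_def by (rule mid_cross[OF poly_fun.const poly_fun.const HOL.refl])
  ultimately show ?thesis by simp
qed

lemma star_cyclic: "cyclic_bimodule n P e'"
  unfolding cyclic_bimodule_def
  using P.bimodule_axioms e'_closed e'_grade P_generated e'_const e'_evaluation by blast

text \<open>
  The middle layer connects the two diagrams. A strand ending at \<open>j\<close> is continued by the one starting
  at \<open>j + 1\<close>, because passing through the left arc of the letter \<open>j\<close> replaces one value by the other.
\<close>

lemma star_strands: "strands n j P e' (attach_letter j \<pi>)"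
  unfolding strands_def
proof (intro conjI ballI allI impI)
  fix r x assume "r \<in> carrier R" "\<forall>v\<in>V. r v = 0" "x \<in> carrier P"
  then show "rsmult P x r = \<zero>\<^bsub>P\<^esub>"
    by (intro P.rsmult_eq_zero Bj_right_annihilated) auto
next
  have one: "(\<lambda>_. 1) \<in> (poly_fun :: ('k point \<Rightarrow> 'k) set)" by (rule poly_fun.const)
  have through: "mid (\<lambda>v. v m) = smult P (Z_fun n (\<lambda>v. v p)) e'" if "\<pi> m = Left p" for m p
    using mid_strand_through[OF that one] by (simp add: e'_def)
  have turned: "mid (\<lambda>v. v m) = mid (\<lambda>v. v j + v (Suc j) - v m')" if "\<pi> m = Right m'" for m m'
    using mid_strand_back[OF that one] by simp
  have cross: "mid (\<lambda>v. v m) = rsmult P e' (Z_fun n (\<lambda>v. v m))"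
    "mid (\<lambda>v. v j + v (Suc j) - v m) = rsmult P e' (Z_fun n (\<lambda>v. v j + v (Suc j) - v m))"
    if "m \<noteq> j" "m \<noteq> Suc j" for m
    using mid_coord_cross[OF that one] mid_reflected_cross[OF that one] by (simp_all add: e'_def)
  have joined: "mid (\<lambda>v. v m) = mid (\<lambda>v. v (Suc j))" if "\<pi> m = Right j" for m
    using turned[OF that] by simp
  have joined': "mid (\<lambda>v. v m) = mid (\<lambda>v. v j)" if "\<pi> m = Right (Suc j)" for m
    using turned[OF that] by simp
  fix m
  { fix p assume a: "attach_letter j \<pi> m = Left p"
    then have m: "m \<noteq> j" "m \<noteq> Suc j" by (auto simp: attach_letter_def split: if_splits)
    then have "mid (\<lambda>v. v m) = smult P (Z_fun n (\<lambda>v. v p)) e'"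
      using a through joined joined' by (auto simp: attach_letter_def split: if_splits)
    then show "rsmult P e' (Z_fun n (\<lambda>v. v m)) = smult P (Z_fun n (\<lambda>v. v p)) e'"
      using cross(1)[OF m] by simp }
  { fix m' assume a: "attach_letter j \<pi> m = Right m'"
    show "rsmult P e' (Z_fun n (\<lambda>v. v m)) = rsmult P e' (Z_fun n (\<lambda>v. v j + v (Suc j) - v m'))"
    proof (cases "m = j \<or> m = Suc j")
      case True
      then show ?thesis using a by (auto simp: attach_letter_def)
    next
      case False
      then have m: "m \<noteq> j" "m \<noteq> Suc j" by auto
      have "m' \<noteq> j \<and> m' \<noteq> Suc j \<and> mid (\<lambda>v. v m) = mid (\<lambda>v. v j + v (Suc j) - v m')"
        using a m turned joined joined' open_left open_right
        by (fastforce simp: attach_letter_def split: if_splits)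
      then show ?thesis using cross(1)[OF m] cross(2) by simp
    qed }
qed

end


section \<open>Graded bimodules with a cyclic generator in degree zero\<close>

text \<open>
  The submodule of elements without components in degrees at most zero, given by sums rather than by
  components, so that closure under the actions is immediate.
\<close>

inductive_set positive_part :: "('r, 'b) gbimod \<Rightarrow> 'b set" for M where
  zero: "\<zero>\<^bsub>M\<^esub> \<in> positive_part M"
| gen: "\<lbrakk>x \<in> grade M d; 0 < d\<rbrakk> \<Longrightarrow> x \<in> positive_part M"
| add: "\<lbrakk>x \<in> positive_part M; y \<in> positive_part M\<rbrakk> \<Longrightarrow> x \<oplus>\<^bsub>M\<^esub> y \<in> positive_part M"

locale graded_bimod =
  fixes R S :: "'r graded_ring" and M :: "('r, 'b) gbimod"
  assumes graded: "graded_bimodule R S M"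
begin

sublocale module R M
  using graded by (simp add: graded_bimodule_def)

lemma grade_subgroup: "subgroup (grade M d) (add_monoid M)"
  using graded by (simp add: graded_bimodule_def)

lemma right_module: "module S (M\<lparr>smult := \<lambda>s m. rsmult M m s\<rparr>)"
  using graded by (simp add: graded_bimodule_def)

lemma
  shows rsmult_closed: "\<lbrakk>s \<in> carrier S; x \<in> carrier M\<rbrakk> \<Longrightarrow> rsmult M x s \<in> carrier M"
    and rsmult_add_ring: "\<lbrakk>s \<in> carrier S; t \<in> carrier S; x \<in> carrier M\<rbrakk> \<Longrightarrow>
      rsmult M x (s \<oplus>\<^bsub>S\<^esub> t) = rsmult M x s \<oplus>\<^bsub>M\<^esub> rsmult M x t"
    and rsmult_add: "\<lbrakk>s \<in> carrier S; x \<in> carrier M; y \<in> carrier M\<rbrakk> \<Longrightarrow>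
      rsmult M (x \<oplus>\<^bsub>M\<^esub> y) s = rsmult M x s \<oplus>\<^bsub>M\<^esub> rsmult M y s"
    and rsmult_mult: "\<lbrakk>s \<in> carrier S; t \<in> carrier S; x \<in> carrier M\<rbrakk> \<Longrightarrow>
      rsmult M x (s \<otimes>\<^bsub>S\<^esub> t) = rsmult M (rsmult M x t) s"
    and rsmult_zero: "s \<in> carrier S \<Longrightarrow> rsmult M \<zero>\<^bsub>M\<^esub> s = \<zero>\<^bsub>M\<^esub>"
proof -
  interpret r: module S "M\<lparr>smult := \<lambda>s m. rsmult M m s\<rparr>" by (rule right_module)
  show "\<lbrakk>s \<in> carrier S; x \<in> carrier M\<rbrakk> \<Longrightarrow> rsmult M x s \<in> carrier M" using r.smult_closed by simp
  show "\<lbrakk>s \<in> carrier S; t \<in> carrier S; x \<in> carrier M\<rbrakk> \<Longrightarrow>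
      rsmult M x (s \<oplus>\<^bsub>S\<^esub> t) = rsmult M x s \<oplus>\<^bsub>M\<^esub> rsmult M x t"
    using r.smult_l_distr[of s t x] by simp
  show "\<lbrakk>s \<in> carrier S; x \<in> carrier M; y \<in> carrier M\<rbrakk> \<Longrightarrow>
      rsmult M (x \<oplus>\<^bsub>M\<^esub> y) s = rsmult M x s \<oplus>\<^bsub>M\<^esub> rsmult M y s"
    using r.smult_r_distr[of s x y] by simp
  show "\<lbrakk>s \<in> carrier S; t \<in> carrier S; x \<in> carrier M\<rbrakk> \<Longrightarrow>
      rsmult M x (s \<otimes>\<^bsub>S\<^esub> t) = rsmult M (rsmult M x t) s"
    using r.smult_assoc1[of s t x] by simp
  show "s \<in> carrier S \<Longrightarrow> rsmult M \<zero>\<^bsub>M\<^esub> s = \<zero>\<^bsub>M\<^esub>"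
    using r.smult_r_null[of s] by simp
qed

lemma rsmult_smult:
  "\<lbrakk>r \<in> carrier R; s \<in> carrier S; x \<in> carrier M\<rbrakk> \<Longrightarrow>
    rsmult M (smult M r x) s = smult M r (rsmult M x s)"
  using graded by (simp add: graded_bimodule_def)

lemma grade_closed: "x \<in> grade M d \<Longrightarrow> x \<in> carrier M"
  using subgroup.mem_carrier[OF grade_subgroup] by simp

lemma grade_add: "\<lbrakk>x \<in> grade M d; y \<in> grade M d\<rbrakk> \<Longrightarrow> x \<oplus>\<^bsub>M\<^esub> y \<in> grade M d"
  using subgroup.m_closed[OF grade_subgroup] by simp

lemma grade_zero: "\<zero>\<^bsub>M\<^esub> \<in> grade M d"
  using subgroup.one_closed[OF grade_subgroup] by simp

lemma grade_minus: "x \<in> grade M d \<Longrightarrow> \<ominus>\<^bsub>M\<^esub> x \<in> grade M d"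
  using subgroup.m_inv_closed[OF grade_subgroup] by (simp add: a_inv_def)

lemma grade_smult:
  "\<lbrakk>r \<in> ring_grade R a; x \<in> grade M d\<rbrakk> \<Longrightarrow> smult M r x \<in> grade M (a + d)"
  using graded unfolding graded_bimodule_def by blast

lemma grade_rsmult:
  "\<lbrakk>s \<in> ring_grade S a; x \<in> grade M d\<rbrakk> \<Longrightarrow> rsmult M x s \<in> grade M (d + a)"
  using graded unfolding graded_bimodule_def by blast

lemma decomposition_unique:
  assumes c: "\<And>d. c d \<in> grade M d" and c': "\<And>d. c' d \<in> grade M d"
    and A: "finite A" "\<And>d. d \<notin> A \<Longrightarrow> c d = \<zero>\<^bsub>M\<^esub>" "\<And>d. d \<notin> A \<Longrightarrow> c' d = \<zero>\<^bsub>M\<^esub>"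
    and eq: "finsum M c A = finsum M c' A"
  shows "c = c'"
proof -
  have supp: "finite {d. f d \<noteq> \<zero>\<^bsub>M\<^esub>} \<and> finsum M f {d. f d \<noteq> \<zero>\<^bsub>M\<^esub>} = finsum M f A"
    if f: "\<And>d. f d \<in> grade M d" "\<And>d. d \<notin> A \<Longrightarrow> f d = \<zero>\<^bsub>M\<^esub>" for f
  proof -
    have cl: "f d \<in> carrier M" for d by (rule grade_closed[OF f(1)])
    have sub: "{d. f d \<noteq> \<zero>\<^bsub>M\<^esub>} \<subseteq> A" using f(2) by blast
    moreover have "finsum M f {d. f d \<noteq> \<zero>\<^bsub>M\<^esub>} = finsum M f A"
      by (rule add.finprod_mono_neutral_cong_left) (use sub A(1) cl in auto)
    ultimately show ?thesis using A(1) finite_subset by blast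
  qed
  have "finsum M c A \<in> carrier M" using grade_closed[OF c] by (intro finsum_closed) auto
  then have ex1: "\<exists>!c'. (\<forall>d. c' d \<in> grade M d) \<and> finite {d. c' d \<noteq> \<zero>\<^bsub>M\<^esub>} \<and>
      finsum M c A = finsum M c' {d. c' d \<noteq> \<zero>\<^bsub>M\<^esub>}"
    using graded unfolding graded_bimodule_def by blast
  show ?thesis
  proof (rule ex1E[OF ex1])
    fix f assume uniq: "\<forall>g. (\<forall>d. g d \<in> grade M d) \<and> finite {d. g d \<noteq> \<zero>\<^bsub>M\<^esub>} \<and>
      finsum M c A = finsum M g {d. g d \<noteq> \<zero>\<^bsub>M\<^esub>} \<longrightarrow> g = f"
    have "c = f" by (rule uniq[rule_format]) (use c supp[of c, OF c A(2)] in simp)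
    moreover have "c' = f" by (rule uniq[rule_format]) (use c' supp[of c', OF c' A(3)] eq in simp)
    ultimately show "c = c'" by simp
  qed
qed

lemma positive_part_closed: "x \<in> positive_part M \<Longrightarrow> x \<in> carrier M"
  by (induction rule: positive_part.induct) (auto dest: grade_closed)

lemma positive_part_decomposition:
  assumes "x \<in> positive_part M"
  shows "\<exists>c A. (\<forall>d. c d \<in> grade M d) \<and> finite A \<and> (\<forall>d \<in> A. 0 < d) \<and>
    (\<forall>d. d \<notin> A \<longrightarrow> c d = \<zero>\<^bsub>M\<^esub>) \<and> x = finsum M c A"
  using assms
proof (induction rule: positive_part.induct)
  case zero
  show ?case by (intro exI[of _ "\<lambda>_. \<zero>\<^bsub>M\<^esub>"] exI[of _ "{}"]) (simp add: grade_zero)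
next
  case (gen x d)
  show ?case
    by (intro exI[of _ "\<lambda>d'. if d' = d then x else \<zero>\<^bsub>M\<^esub>"] exI[of _ "{d}"])
      (use gen in \<open>auto simp: grade_zero grade_closed\<close>)
next
  case (add x y)
  then obtain c A c' A' where
    c: "\<forall>d. c d \<in> grade M d" "finite A" "\<forall>d \<in> A. 0 < d" "\<forall>d. d \<notin> A \<longrightarrow> c d = \<zero>\<^bsub>M\<^esub>" "x = finsum M c A"
    and c': "\<forall>d. c' d \<in> grade M d" "finite A'" "\<forall>d \<in> A'. 0 < d" "\<forall>d. d \<notin> A' \<longrightarrow> c' d = \<zero>\<^bsub>M\<^esub>" "y = finsum M c' A'"
    by blast
  have cl: "c d \<in> carrier M" "c' d \<in> carrier M" for d by (rule grade_closed, use c c' in blast)+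
  have "x = finsum M c (A \<union> A')"
    unfolding c(5) by (rule add.finprod_mono_neutral_cong_left) (use c c' cl in auto)
  moreover have "y = finsum M c' (A \<union> A')"
    unfolding c'(5) by (rule add.finprod_mono_neutral_cong_left) (use c c' cl in auto)
  ultimately have "x \<oplus>\<^bsub>M\<^esub> y = finsum M (\<lambda>d. c d \<oplus>\<^bsub>M\<^esub> c' d) (A \<union> A')"
    using cl by (simp add: finsum_addf)
  then show ?case
    by (intro exI[of _ "\<lambda>d. c d \<oplus>\<^bsub>M\<^esub> c' d"] exI[of _ "A \<union> A'"])
      (use c c' in \<open>auto simp: grade_add\<close>)
qed

lemma positive_part_grade_zero:
  assumes x: "x \<in> positive_part M" "x \<in> grade M 0"
  shows "x = \<zero>\<^bsub>M\<^esub>"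
proof -
  obtain c A where c: "\<forall>d. c d \<in> grade M d" "finite A" "\<forall>d \<in> A. 0 < d"
    "\<forall>d. d \<notin> A \<longrightarrow> c d = \<zero>\<^bsub>M\<^esub>" "x = finsum M c A"
    using positive_part_decomposition[OF x(1)] by blast
  define c' where "c' = (\<lambda>d::int. if d = 0 then x else \<zero>\<^bsub>M\<^esub>)"
  have cl: "c d \<in> carrier M" for d by (rule grade_closed, use c in blast)
  have x_closed: "x \<in> carrier M" by (rule grade_closed[OF x(2)])
  have c'g: "c' d \<in> grade M d" for d using x(2) by (simp add: c'_def grade_zero)
  have "finsum M c (insert 0 A) = x"
    unfolding c(5) by (rule add.finprod_mono_neutral_cong_left[symmetric]) (use c cl in auto)
  moreover have "finsum M c' (insert 0 A) = finsum M c' {0}"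
    by (rule add.finprod_mono_neutral_cong_left[symmetric])
      (use c x_closed in \<open>auto simp: c'_def\<close>)
  moreover have "finsum M c' {0} = x"
    using x_closed by (simp add: c'_def)
  ultimately have "c = c'"
    by (intro decomposition_unique[of c c' "insert 0 A"]) (use c c'g in \<open>auto simp: c'_def\<close>)
  moreover have "c 0 = \<zero>\<^bsub>M\<^esub>" using c by blast
  ultimately show ?thesis by (simp add: c'_def fun_eq_iff)
qed

lemma positive_part_smult:
  assumes "r \<in> ring_grade R a" "r \<in> carrier R" "0 \<le> a" "x \<in> positive_part M"
  shows "smult M r x \<in> positive_part M"
  using assms(4)
proof (induction rule: positive_part.induct)
  case (gen x d)
  then show ?case by (intro positive_part.gen[OF grade_smult[OF assms(1) gen(1)]]) (use assms(3) in simp)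
qed (use assms in \<open>simp_all add: smult_r_distr positive_part_closed positive_part.zero positive_part.add\<close>)

lemma positive_part_rsmult:
  assumes "s \<in> ring_grade S a" "s \<in> carrier S" "0 \<le> a" "x \<in> positive_part M"
  shows "rsmult M x s \<in> positive_part M"
  using assms(4)
proof (induction rule: positive_part.induct)
  case (gen x d)
  then show ?case by (intro positive_part.gen[OF grade_rsmult[OF assms(1) gen(1)]]) (use assms(3) in simp)
qed (use assms in \<open>simp_all add: rsmult_add rsmult_zero positive_part_closed positive_part.zero positive_part.add\<close>)

lemma idempotent_zero: "x \<in> carrier M \<Longrightarrow> x \<oplus>\<^bsub>M\<^esub> x = x \<Longrightarrow> x = \<zero>\<^bsub>M\<^esub>"
  using M.add.l_cancel_one'[of x x] by simp

end

lemma Rbar_add: "f \<oplus>\<^bsub>Rbar n\<^esub> g = (\<lambda>v. f v + g v)"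
  and Rbar_zero: "\<zero>\<^bsub>Rbar n\<^esub> = (\<lambda>_. 0)"
  by (simp_all add: Rbar_def regular_ring_def)

lemma Z_fun_add: "Z_fun n p \<oplus>\<^bsub>Rbar n\<^esub> Z_fun n q = Z_fun n (\<lambda>v. p v + q v)"
  and Z_fun_mult: "Z_fun n p \<otimes>\<^bsub>Rbar n\<^esub> Z_fun n q = Z_fun n (\<lambda>v. p v * q v)"
  and Z_fun_zero: "Z_fun n (\<lambda>_. 0) = \<zero>\<^bsub>Rbar n\<^esub>"
  by (auto simp: Rbar_add Rbar_mult Rbar_zero restr_def fun_eq_iff)

lemma Z_fun_const_grade: "Z_fun n (\<lambda>_. c) \<in> ring_grade (Rbar n) 0"
  by (simp add: Rbar_def regular_ring_def homog_poly_fun.const)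

lemma Z_fun_coord_grade: "Z_fun n (\<lambda>v. v m) \<in> ring_grade (Rbar n) 2"
  using homog_poly_fun.coord[of m] by (auto simp: Rbar_def regular_ring_def)

locale cyclic_graded = graded_bimod "Rbar n" "Rbar n" B
  for n :: nat and B :: "('k::field_char_0 point \<Rightarrow> 'k, 'b) gbimod" +
  fixes b :: 'b
  assumes b_grade: "b \<in> grade B 0"
    and b_generates: "carrier B \<subseteq> generated (Rbar n) (Rbar n) B b"
    and b_const: "smult B (Z_fun n (\<lambda>_. c)) b = rsmult B b (Z_fun n (\<lambda>_. c))"
begin

lemma b_closed: "b \<in> carrier B"
  using b_grade by (rule grade_closed)

lemma const_closed: "Z_fun n (\<lambda>_. c) \<in> carrier (Rbar n)"
  and coord_closed: "Z_fun n (\<lambda>v. v m) \<in> carrier (Rbar n)"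
  by (simp_all add: Z_fun_closed poly_fun.const poly_fun.coord)

text \<open>
  The decomposition \<open>k b + (degree > 0)\<close>. It is stable under both actions, since the rings are
  generated by constants and by coordinates of degree 2; hence it exhausts the bimodule.
\<close>

definition leading_multiples :: "'b set" where
  "leading_multiples = {smult B (Z_fun n (\<lambda>_. c)) b \<oplus>\<^bsub>B\<^esub> z |c z. z \<in> positive_part B}"

lemma leading_multiples_closed: "y \<in> leading_multiples \<Longrightarrow> y \<in> carrier B"
  by (auto simp: leading_multiples_def b_closed const_closed positive_part_closed)

lemma leading_multiples_add:
  assumes "y \<in> leading_multiples" "y' \<in> leading_multiples"
  shows "y \<oplus>\<^bsub>B\<^esub> y' \<in> leading_multiples"
proof -
  obtain c z c' z' where y: "y = smult B (Z_fun n (\<lambda>_. c)) b \<oplus>\<^bsub>B\<^esub> z" "z \<in> positive_part B"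
    "y' = smult B (Z_fun n (\<lambda>_. c')) b \<oplus>\<^bsub>B\<^esub> z'" "z' \<in> positive_part B"
    using assms by (auto simp: leading_multiples_def)
  have "y \<oplus>\<^bsub>B\<^esub> y' = smult B (Z_fun n (\<lambda>_. c + c')) b \<oplus>\<^bsub>B\<^esub> (z \<oplus>\<^bsub>B\<^esub> z')"
    unfolding Z_fun_add[symmetric] using y
    by (simp add: smult_l_distr b_closed const_closed positive_part_closed M.a_ac)
  moreover have "z \<oplus>\<^bsub>B\<^esub> z' \<in> positive_part B" using y by (intro positive_part.add)
  ultimately show ?thesis unfolding leading_multiples_def by blast
qed

lemma positive_leading: "z \<in> positive_part B \<Longrightarrow> z \<in> leading_multiples"
  unfolding leading_multiples_def
  by (rule CollectI, rule exI[of _ 0], rule exI[of _ z])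
    (simp add: Z_fun_zero b_closed positive_part_closed)

lemma leading_multiples_smult:
  assumes "p \<in> poly_fun"
  shows "y \<in> leading_multiples \<Longrightarrow> smult B (Z_fun n p) y \<in> leading_multiples"
  using assms
proof (induction arbitrary: y rule: poly_fun.induct)
  case (const c)
  then obtain c' z where y: "y = smult B (Z_fun n (\<lambda>_. c')) b \<oplus>\<^bsub>B\<^esub> z" "z \<in> positive_part B"
    by (auto simp: leading_multiples_def)
  have "smult B (Z_fun n (\<lambda>_. c)) y = smult B (Z_fun n (\<lambda>_. c * c')) b \<oplus>\<^bsub>B\<^esub> smult B (Z_fun n (\<lambda>_. c)) z"
    unfolding Z_fun_mult[symmetric] using y
    by (simp add: smult_r_distr smult_assoc1 b_closed const_closed positive_part_closed)
  moreover have "smult B (Z_fun n (\<lambda>_. c)) z \<in> positive_part B"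
    by (rule positive_part_smult[OF Z_fun_const_grade const_closed _ y(2)]) simp
  ultimately show ?case unfolding leading_multiples_def by blast
next
  case (coord m)
  then obtain c' z where y: "y = smult B (Z_fun n (\<lambda>_. c')) b \<oplus>\<^bsub>B\<^esub> z" "z \<in> positive_part B"
    by (auto simp: leading_multiples_def)
  have "smult B (Z_fun n (\<lambda>_. c')) b \<in> grade B 0"
    using grade_smult[OF Z_fun_const_grade b_grade] by simp
  from positive_part.gen[OF grade_smult[OF Z_fun_coord_grade this]]
  have "smult B (Z_fun n (\<lambda>v. v m)) (smult B (Z_fun n (\<lambda>_. c')) b) \<in> positive_part B" by simp
  moreover have "smult B (Z_fun n (\<lambda>v. v m)) z \<in> positive_part B"
    by (rule positive_part_smult[OF Z_fun_coord_grade coord_closed _ y(2)]) simp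
  ultimately show ?case
    using y by (intro positive_leading)
      (simp add: smult_r_distr b_closed const_closed coord_closed positive_part_closed positive_part.add)
next
  case (add p q)
  then show ?case
    unfolding Z_fun_add[symmetric]
    by (simp add: smult_l_distr Z_fun_closed leading_multiples_closed leading_multiples_add)
next
  case (mult p q)
  then show ?case
    unfolding Z_fun_mult[symmetric]
    by (simp add: smult_assoc1 Z_fun_closed leading_multiples_closed)
qed

lemma leading_multiples_rsmult:
  assumes "p \<in> poly_fun"
  shows "y \<in> leading_multiples \<Longrightarrow> rsmult B y (Z_fun n p) \<in> leading_multiples"
  using assms
proof (induction arbitrary: y rule: poly_fun.induct)
  case (const c)
  then obtain c' z where y: "y = smult B (Z_fun n (\<lambda>_. c')) b \<oplus>\<^bsub>B\<^esub> z" "z \<in> positive_part B"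
    by (auto simp: leading_multiples_def)
  have "rsmult B y (Z_fun n (\<lambda>_. c)) = smult B (Z_fun n (\<lambda>_. c' * c)) b \<oplus>\<^bsub>B\<^esub> rsmult B z (Z_fun n (\<lambda>_. c))"
    unfolding Z_fun_mult[symmetric] using y
    by (simp add: rsmult_add rsmult_smult smult_assoc1 b_const[symmetric] b_closed const_closed
        positive_part_closed)
  moreover have "rsmult B z (Z_fun n (\<lambda>_. c)) \<in> positive_part B"
    by (rule positive_part_rsmult[OF Z_fun_const_grade const_closed _ y(2)]) simp
  ultimately show ?case unfolding leading_multiples_def by blast
next
  case (coord m)
  then obtain c' z where y: "y = smult B (Z_fun n (\<lambda>_. c')) b \<oplus>\<^bsub>B\<^esub> z" "z \<in> positive_part B"
    by (auto simp: leading_multiples_def)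
  have "smult B (Z_fun n (\<lambda>_. c')) b \<in> grade B 0"
    using grade_smult[OF Z_fun_const_grade b_grade] by simp
  from positive_part.gen[OF grade_rsmult[OF Z_fun_coord_grade this]]
  have "rsmult B (smult B (Z_fun n (\<lambda>_. c')) b) (Z_fun n (\<lambda>v. v m)) \<in> positive_part B" by simp
  moreover have "rsmult B z (Z_fun n (\<lambda>v. v m)) \<in> positive_part B"
    by (rule positive_part_rsmult[OF Z_fun_coord_grade coord_closed _ y(2)]) simp
  ultimately show ?case
    using y by (intro positive_leading)
      (simp add: rsmult_add b_closed const_closed coord_closed positive_part_closed positive_part.add)
next
  case (add p q)
  then show ?case
    unfolding Z_fun_add[symmetric]
    by (simp add: rsmult_add_ring Z_fun_closed leading_multiples_closed leading_multiples_add)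
next
  case (mult p q)
  then show ?case
    unfolding Z_fun_mult[symmetric]
    by (simp add: rsmult_mult Z_fun_closed leading_multiples_closed)
qed

lemma all_leading_multiples: "carrier B \<subseteq> leading_multiples"
proof
  fix y assume "y \<in> carrier B"
  then have "y \<in> generated (Rbar n) (Rbar n) B b" using b_generates by blast
  then show "y \<in> leading_multiples"
  proof (induction rule: generated.induct)
    case zero
    show ?case by (rule positive_leading[OF positive_part.zero])
  next
    case (gen r s)
    then obtain p q where pq: "p \<in> poly_fun" "r = Z_fun n p" "q \<in> poly_fun" "s = Z_fun n q"
      by (auto simp: Rbar_carrier)
    have "smult B (Z_fun n (\<lambda>_. 1)) b \<oplus>\<^bsub>B\<^esub> \<zero>\<^bsub>B\<^esub> = b"
      using b_closed smult_one by (simp add: Rbar_one)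
    then have "b \<in> leading_multiples"
      using positive_part.zero[of B] unfolding leading_multiples_def
      by (intro CollectI exI[of _ 1] exI[of _ "\<zero>\<^bsub>B\<^esub>"]) simp
    from leading_multiples_smult[OF pq(1) leading_multiples_rsmult[OF pq(3) this]]
    show ?case unfolding pq(2,4) .
  next
    case (add x y)
    then show ?case by (intro leading_multiples_add)
  qed
qed

lemma grade_zero_multiple:
  assumes y: "y \<in> grade B 0"
  obtains c where "y = smult B (Z_fun n (\<lambda>_. c)) b"
proof -
  obtain c z where cz: "y = smult B (Z_fun n (\<lambda>_. c)) b \<oplus>\<^bsub>B\<^esub> z" "z \<in> positive_part B"
    using all_leading_multiples grade_closed[OF y] unfolding leading_multiples_def by blast
  let ?cb = "smult B (Z_fun n (\<lambda>_. c)) b"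
  have cb: "?cb \<in> grade B 0" "?cb \<in> carrier B"
    using grade_smult[OF Z_fun_const_grade b_grade] b_closed const_closed by auto
  have "z = \<ominus>\<^bsub>B\<^esub> ?cb \<oplus>\<^bsub>B\<^esub> y"
    using cz cb positive_part_closed by (simp add: M.r_neg1)
  then have "z \<in> grade B 0" using cb y by (simp add: grade_add grade_minus)
  then have "z = \<zero>\<^bsub>B\<^esub>" using cz positive_part_grade_zero by blast
  then show thesis using that cz cb by simp
qed

lemma hom_vanishes:
  assumes N: "graded_bimodule (Rbar n) (Rbar n) N"
    and h: "h \<in> bimod_hom (Rbar n) (Rbar n) B N" and hb: "h b = \<zero>\<^bsub>N\<^esub>" and y: "y \<in> carrier B"
  shows "h y = \<zero>\<^bsub>N\<^esub>"
proof -
  interpret N: graded_bimod "Rbar n" "Rbar n" N by unfold_locales (rule N)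
  have h0: "h x \<in> carrier N" if "x \<in> carrier B" for x
    using h that by (auto simp: bimod_hom_def)
  have h1: "h (x \<oplus>\<^bsub>B\<^esub> x') = h x \<oplus>\<^bsub>N\<^esub> h x'" if "x \<in> carrier B" "x' \<in> carrier B" for x x'
    using h that by (auto simp: bimod_hom_def)
  have h2: "h (smult B r x) = smult N r (h x)" "h (rsmult B x r) = rsmult N (h x) r"
    if "r \<in> carrier (Rbar n)" "x \<in> carrier B" for r x
    using h that by (auto simp: bimod_hom_def)
  have "y \<in> generated (Rbar n) (Rbar n) B b" using y b_generates by blast
  then have "y \<in> carrier B \<and> h y = \<zero>\<^bsub>N\<^esub>"
  proof (induction rule: generated.induct)
    case zero
    have "h \<zero>\<^bsub>B\<^esub> \<oplus>\<^bsub>N\<^esub> h \<zero>\<^bsub>B\<^esub> = h \<zero>\<^bsub>B\<^esub>" using h1[of "\<zero>\<^bsub>B\<^esub>" "\<zero>\<^bsub>B\<^esub>"] by simp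
    then show ?case using N.idempotent_zero h0 by simp
  next
    case (gen r s)
    then show ?case by (simp add: h2 rsmult_closed b_closed hb N.rsmult_zero)
  next
    case (add x y)
    then show ?case by (simp add: h1)
  qed
  then show ?thesis ..
qed

text \<open>
  The degree zero part is \<open>k b\<close>. It splits along any decomposition of \<open>B\<close> and is one-dimensional, so
  \<open>b\<close> lies in one of the summands, and the other summand, generated by the projection of \<open>b\<close>, vanishes.
\<close>

lemma indecomposable:
  assumes "b \<noteq> \<zero>\<^bsub>B\<^esub>"
  shows "indecomposable (Rbar n) (Rbar n) B"
  unfolding indecomposable_def
proof (intro conjI allI impI)
  show "carrier B \<noteq> {\<zero>\<^bsub>B\<^esub>}" using assms b_closed by blast
next
  fix M N :: "('k point \<Rightarrow> 'k, 'b) gbimod"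
  assume M: "graded_bimodule (Rbar n) (Rbar n) M" and N: "graded_bimodule (Rbar n) (Rbar n) N"
    and iso: "bimod_iso (Rbar n) (Rbar n) B (bimod_sum M N)"
  interpret M: graded_bimod "Rbar n" "Rbar n" M by unfold_locales (rule M)
  interpret N: graded_bimod "Rbar n" "Rbar n" N by unfold_locales (rule N)
  let ?S = "bimod_sum M N"
  obtain \<phi> \<psi> where \<phi>: "\<phi> \<in> bimod_hom (Rbar n) (Rbar n) B ?S" and \<psi>: "\<psi> \<in> bimod_hom (Rbar n) (Rbar n) ?S B"
    and \<phi>\<psi>: "\<And>y. y \<in> carrier ?S \<Longrightarrow> \<phi> (\<psi> y) = y"
    using iso by (auto simp: bimod_iso_def)
  have \<phi>_closed: "\<phi> x \<in> carrier M \<times> carrier N" if "x \<in> carrier B" for x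
    using \<phi> that by (auto simp: bimod_hom_def bimod_sum_def)
  have homs: "fst \<circ> \<phi> \<in> bimod_hom (Rbar n) (Rbar n) B M" "snd \<circ> \<phi> \<in> bimod_hom (Rbar n) (Rbar n) B N"
    using \<phi> by (auto simp: bimod_hom_def bimod_sum_def case_prod_unfold image_subset_iff Pi_iff mem_Times_iff)
  obtain e1 e2 where e: "\<phi> b = (e1, e2)" by (cases "\<phi> b")
  have e12: "e1 \<in> carrier M" "e2 \<in> carrier N" using \<phi>_closed[OF b_closed] e by auto
  have "e1 \<in> grade M 0" using \<phi> b_grade e by (force simp: bimod_hom_def bimod_sum_def)
  then have e10: "(e1, \<zero>\<^bsub>N\<^esub>) \<in> grade ?S 0" "(e1, \<zero>\<^bsub>N\<^esub>) \<in> carrier ?S"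
    by (simp_all add: bimod_sum_def N.grade_zero e12)
  \<comment> \<open>The component of \<open>b\<close> in the first summand lies in degree 0 of \<open>B\<close>, hence is a multiple of \<open>b\<close>.\<close>
  then have "\<psi> (e1, \<zero>\<^bsub>N\<^esub>) \<in> grade B 0" using \<psi> by (force simp: bimod_hom_def)
  then obtain c where c: "\<psi> (e1, \<zero>\<^bsub>N\<^esub>) = smult B (Z_fun n (\<lambda>_. c)) b" by (rule grade_zero_multiple)
  have "(e1, \<zero>\<^bsub>N\<^esub>) = \<phi> (smult B (Z_fun n (\<lambda>_. c)) b)" using \<phi>\<psi>[OF e10(2)] c by simp
  also have "\<dots> = smult ?S (Z_fun n (\<lambda>_. c)) (e1, e2)"
    using \<phi> b_closed const_closed[of c] e by (simp add: bimod_hom_def)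
  finally have c12: "e1 = smult M (Z_fun n (\<lambda>_. c)) e1" "\<zero>\<^bsub>N\<^esub> = smult N (Z_fun n (\<lambda>_. c)) e2"
    by (simp_all add: bimod_sum_def)
  have "e1 = \<zero>\<^bsub>M\<^esub> \<or> e2 = \<zero>\<^bsub>N\<^esub>"
  proof (cases "c = 0")
    case True
    then show ?thesis using c12(1) e12 by (simp add: Z_fun_zero)
  next
    case False
    have "e2 = smult N (Z_fun n (\<lambda>_. 1 / c) \<otimes>\<^bsub>Rbar n\<^esub> Z_fun n (\<lambda>_. c)) e2"
      using False e12 N.smult_one by (simp add: Z_fun_mult Rbar_one)
    also have "\<dots> = smult N (Z_fun n (\<lambda>_. 1 / c)) \<zero>\<^bsub>N\<^esub>"
      unfolding c12(2) by (rule N.smult_assoc1[OF const_closed const_closed e12(2)])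
    also have "\<dots> = \<zero>\<^bsub>N\<^esub>" by (rule N.smult_r_null[OF const_closed])
    finally show ?thesis ..
  qed
  then show "carrier M = {\<zero>\<^bsub>M\<^esub>} \<or> carrier N = {\<zero>\<^bsub>N\<^esub>}"
  proof
    assume "e1 = \<zero>\<^bsub>M\<^esub>"
    then have van: "fst (\<phi> y) = \<zero>\<^bsub>M\<^esub>" if "y \<in> carrier B" for y
      using hom_vanishes[OF M homs(1) _ that] e by simp
    have "m = \<zero>\<^bsub>M\<^esub>" if m: "m \<in> carrier M" for m
    proof -
      have "(m, \<zero>\<^bsub>N\<^esub>) \<in> carrier ?S" using m by (simp add: bimod_sum_def)
      then show ?thesis using van[of "\<psi> (m, \<zero>\<^bsub>N\<^esub>)"] \<phi>\<psi> \<psi> by (auto simp: bimod_hom_def Pi_iff)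
    qed
    then show ?thesis by auto
  next
    assume "e2 = \<zero>\<^bsub>N\<^esub>"
    then have van: "snd (\<phi> y) = \<zero>\<^bsub>N\<^esub>" if "y \<in> carrier B" for y
      using hom_vanishes[OF N homs(2) _ that] e by simp
    have "m = \<zero>\<^bsub>N\<^esub>" if m: "m \<in> carrier N" for m
    proof -
      have "(\<zero>\<^bsub>M\<^esub>, m) \<in> carrier ?S" using m by (simp add: bimod_sum_def)
      then show ?thesis using van[of "\<psi> (\<zero>\<^bsub>M\<^esub>, m)"] \<phi>\<psi> \<psi> by (auto simp: bimod_hom_def Pi_iff)
    qed
    then show ?thesis by auto
  qed
qed

end

section \<open>Fully commutative bimodules\<close>

lemma indecomposable_if_iso_cyclic:
  fixes B :: "('k::field_char_0 point \<Rightarrow> 'k, 'b) gbimod" and W :: "('k point \<Rightarrow> 'k, 'c) gbimod"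
  assumes B: "graded_bimodule (Rbar n) (Rbar n) B" and iso: "bimod_iso (Rbar n) (Rbar n) B W"
    and W: "cyclic_bimodule n W e"
  shows "indecomposable (Rbar n) (Rbar n) B"
proof -
  interpret B: graded_bimod "Rbar n" "Rbar n" B by unfold_locales (rule B)
  interpret W: bimodule "Rbar n" "Rbar n" W using W by (simp add: cyclic_bimodule_def)
  have e: "e \<in> carrier W" "e \<in> grade W 0" "carrier W \<subseteq> generated (Rbar n) (Rbar n) W e"
    "smult W (Z_fun n (\<lambda>_. c)) e = rsmult W e (Z_fun n (\<lambda>_. c))" for c
    using W by (simp_all add: cyclic_bimodule_def)
  obtain \<epsilon> where \<epsilon>: "evaluation (Rbar n) (Rbar n) W (alternating_point n) \<epsilon>" "\<epsilon> e = 1"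
    using W by (auto simp: cyclic_bimodule_def)
  obtain \<phi> \<psi> where \<phi>: "\<phi> \<in> bimod_hom (Rbar n) (Rbar n) B W" and \<psi>: "\<psi> \<in> bimod_hom (Rbar n) (Rbar n) W B"
    and \<psi>\<phi>: "\<And>x. x \<in> carrier B \<Longrightarrow> \<psi> (\<phi> x) = x" and \<phi>\<psi>: "\<And>y. y \<in> carrier W \<Longrightarrow> \<phi> (\<psi> y) = y"
    using iso by (auto simp: bimod_iso_def)
  have h: "\<psi> x \<in> carrier B" "x' \<in> carrier W \<Longrightarrow> \<psi> (x \<oplus>\<^bsub>W\<^esub> x') = \<psi> x \<oplus>\<^bsub>B\<^esub> \<psi> x'"
    "r \<in> carrier (Rbar n) \<Longrightarrow> \<psi> (smult W r x) = smult B r (\<psi> x)"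
    "r \<in> carrier (Rbar n) \<Longrightarrow> \<psi> (rsmult W x r) = rsmult B (\<psi> x) r" if "x \<in> carrier W" for x x' r
    using \<psi> that by (auto simp: bimod_hom_def)
  have "\<psi> \<zero>\<^bsub>W\<^esub> \<oplus>\<^bsub>B\<^esub> \<psi> \<zero>\<^bsub>W\<^esub> = \<psi> \<zero>\<^bsub>W\<^esub>"
    using h(2)[OF W.zero_closed W.zero_closed] W.zero_add[OF W.zero_closed] by simp
  then have h0: "\<psi> \<zero>\<^bsub>W\<^esub> = \<zero>\<^bsub>B\<^esub>" using B.idempotent_zero h(1)[OF W.zero_closed] by blast
  have gen: "\<psi> y \<in> generated (Rbar n) (Rbar n) B (\<psi> e)" if "y \<in> generated (Rbar n) (Rbar n) W e" for y
    using that
  proof (induction rule: generated.induct)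
    case zero
    show ?case unfolding h0 by (rule generated.zero)
  next
    case (gen r s)
    then show ?case by (simp add: h W.rsmult_closed e(1) generated.gen)
  next
    case (add x y)
    then show ?case by (simp add: h W.generated_closed[OF e(1)] generated.add)
  qed
  interpret cyclic_graded n B "\<psi> e"
  proof
    have "\<psi> ` grade W 0 \<subseteq> grade B 0" using \<psi> by (simp add: bimod_hom_def)
    then show "\<psi> e \<in> grade B 0" using e(2) by blast
    show "carrier B \<subseteq> generated (Rbar n) (Rbar n) B (\<psi> e)"
    proof
      fix x assume x: "x \<in> carrier B"
      then have "\<phi> x \<in> carrier W" using \<phi> by (auto simp: bimod_hom_def)
      then have "\<psi> (\<phi> x) \<in> generated (Rbar n) (Rbar n) B (\<psi> e)" using gen e(3) by blast
      then show "x \<in> generated (Rbar n) (Rbar n) B (\<psi> e)" using \<psi>\<phi>[OF x] by simp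
    qed
    show "smult B (Z_fun n (\<lambda>_. c)) (\<psi> e) = rsmult B (\<psi> e) (Z_fun n (\<lambda>_. c))" for c
      using h(3,4)[OF e(1) Z_fun_closed[OF poly_fun.const[of c]]] e(4)[of c] by simp
  qed
  show ?thesis
  proof (rule indecomposable)
    show "\<psi> e \<noteq> \<zero>\<^bsub>B\<^esub>"
    proof
      assume "\<psi> e = \<zero>\<^bsub>B\<^esub>"
      then have "e = \<zero>\<^bsub>W\<^esub>" using \<phi>\<psi>[OF e(1)] \<phi>\<psi>[OF W.zero_closed] h0 by simp
      then show False using \<epsilon> by (simp add: evaluation_def)
    qed
  qed
qed

lemma B_word_empty_cyclic:
  assumes "1 \<le> n"
  shows "cyclic_bimodule n (B_word n []) (reg (weyl_lines_union n) (\<lambda>_. 1) :: ('k::field_char_0 point \<Rightarrow> 'k) tens)"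
proof -
  let ?Z = "weyl_lines_union n :: 'k point set" and ?e = "reg (weyl_lines_union n) (\<lambda>_. 1) :: ('k point \<Rightarrow> 'k) tens"
  interpret bimodule "Rbar n" "Rbar n" "regular_bimod ?Z"
    by (intro bimodule_regular acts_Rbar order.refl)
  have e: "?e \<in> carrier (regular_bimod ?Z)" by (intro reg_closed poly_fun.const)
  have "carrier (regular_bimod ?Z) \<subseteq> generated (Rbar n) (Rbar n) (regular_bimod ?Z) ?e"
  proof
    fix x assume "x \<in> carrier (regular_bimod ?Z)"
    then obtain p where p: "p \<in> poly_fun" "x = reg ?Z p" by (rule reg_cases)
    have "x = smult (regular_bimod ?Z) (Z_fun n p) ?e" by (simp add: p reg_smult)
    then show "x \<in> generated (Rbar n) (Rbar n) (regular_bimod ?Z) ?e"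
      using generated_smult[OF e Z_fun_closed[OF p(1)] generated_generator[OF e]] by simp
  qed
  moreover have "alternating_point n \<in> ?Z"
    using alternating_point_in_V_simple[of 1 n] V_simple_subset assms by blast
  then have "\<exists>\<epsilon>. evaluation (Rbar n) (Rbar n) (regular_bimod ?Z) (alternating_point n) \<epsilon> \<and> \<epsilon> ?e = 1"
    using evaluation_regular[of "Rbar n" "Rbar n" ?Z "alternating_point n"]
    by (intro exI conjI) (assumption, simp add: restr_def)
  ultimately show ?thesis
    using e reg_one_grade bimodule_axioms by (simp add: cyclic_bimodule_def reg_smult)
qed

text \<open>
  Appending the letters one at a time: full commutativity ensures that no letter closes a loop of the
  diagram, which is what a product with \<open>B\<^sub>j\<close> needs to stay cyclic.
\<close>

lemma B_word_cyclic_strands: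
  assumes "us \<noteq> []" "spread_word us" "set us \<subseteq> {1..n}"
  shows "\<exists>e. cyclic_bimodule n (B_word n us) (e :: ('k::field_char_0 point \<Rightarrow> 'k) tens) \<and>
    strands n (last us) (B_word n us) e (tl_diagram us)"
  using assms
proof (induction us rule: rev_induct)
  case (snoc j us)
  interpret simple_letter n j "TYPE('k)"
    using snoc.prems by unfold_locales auto
  show ?case
  proof (cases us)
    case Nil
    then show ?thesis using Bj_cyclic Bj_strands by (auto simp: tl_diagram_def)
  next
    case (Cons a as)
    then obtain e :: "('k point \<Rightarrow> 'k) tens" where
      e: "cyclic_bimodule n (B_word n us) e" "strands n (last us) (B_word n us) e (tl_diagram us)"
      using snoc spread_word_prefix by fastforce
    have "last us \<in> set us" using Cons by simp
    then have last: "1 \<le> last us" "last us \<le> n" using snoc.prems(3) by auto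
    interpret strand_step n j "TYPE('k)" "last us" "B_word n us" e "tl_diagram us"
      using e last no_closed_loop[OF snoc.prems(2)] by unfold_locales auto
    have "B_word n (us @ [j]) = star n (B_word n us) (B_simple n j :: ('k point \<Rightarrow> 'k, ('k point \<Rightarrow> 'k) tens) gbimod)"
      using Cons by simp
    then show ?thesis using star_cyclic star_strands by (auto simp: tl_diagram_snoc)
  qed
qed simp

theorem theorem3p19:
  fixes n :: nat
    and B :: "('k::field_char_0 point \<Rightarrow> 'k, 'b) gbimod"
  assumes "n \<ge> 1"
    and "fully_commutative_bimodule n B"
  shows "indecomposable (Rbar n) (Rbar n) B"
proof -
  obtain w ws where B: "graded_bimodule (Rbar n) (Rbar n) B" and w: "fully_commutative n w" "reduced_expr n w ws"
    and iso: "bimod_iso (Rbar n) (Rbar n) B (B_word n ws)"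
    using assms(2) unfolding fully_commutative_bimodule_def by blast
  have "spread_word ws" using fully_commutative_spread[OF w] .
  moreover have "set ws \<subseteq> {1..n}" using w(2) by (simp add: reduced_expr_def)
  ultimately obtain e :: "('k point \<Rightarrow> 'k) tens" where "cyclic_bimodule n (B_word n ws) e"
    using B_word_cyclic_strands B_word_empty_cyclic[OF assms(1)] by (cases "ws = []") blast+
  then show ?thesis by (rule indecomposable_if_iso_cyclic[OF B iso])
qed

end
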